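(* Let $m\ge1$, $1\le k\le m$, and let $a,c\in\mathbb{C}$, $b\in\mathbb{C}^m$ satisfy $a\notin\mathbb{Z}$, $c-a\notin\mathbb{Z}$, $b_l\notin\mathbb{Z}$ $(1\le l\le m)$, $c-\sum_{l=1}^m b_l\notin\mathbb{Z}$ and $c-\sum_{l=1}^{k-1}b_l\notin\mathbb{Z}$. For $x$ in a small neighborhood of $x^{(k)}$, with the twisted cycle $r_k\in H_1(T_x,u_x)$, the form $\varphi_0=\frac{dt}{t-1}$ and the Laurent series $f^{(k)}(a,b,c;x)$ defined in the context, one has $$\int_{r_k}u_x\varphi_0=\Gamma(c-a)\cdot\prod_{l=1}^m\Gamma(1-b_l)\cdot\Gamma\Big(\sum_{l=1}^{k-1}b_l-c\Big)\cdot\Gamma\Big(1-\sum_{l=1}^{k-1}b_l+c\Big)\cdot e^{\pi\sqrt{-1}\left(\sum_{l=1}^{k-1}b_l-c+a\right)}\cdot f^{(k)}(a,b,c;x).$$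
   Context: Put $x_0=0$, $x_{m+1}=1$, $\alpha_0=-c+\sum_{j=1}^m b_j$, $\alpha_l=-b_l$ $(1\le l\le m)$, $\alpha_{m+1}=c-a$, $\alpha_{m+2}=a$, $\lambda_j=e^{2\pi\sqrt{-1}\alpha_j}$; $T_x=\mathbb{C}\setminus\{x_0,\dots,x_{m+1}\}$, $u_x(t)=\prod_{i=0}^{m+1}(t-x_i)^{\alpha_i}$; $H_1(T_x,u_x)$ is the twisted homology group (1-chains loaded with branches of $u_x$). Fix real $\varepsilon,\xi$ with $0<\varepsilon<\frac12$ and $0<\xi<\min\{\varepsilon,\frac1{1+\varepsilon}\}$, and let $x^{(k)}=(\xi,\xi^2,\dots,\xi^{k-1},e^{-\pi\sqrt{-1}}\xi^k,\xi^{k+1},\dots,\xi^m)$, so that at $x^{(k)}$ one takes $\arg x_k=-\pi$ and $\arg x_l=0$ for $l\ne k$ (extended continuously to nearby $x$; powers of $x_l$ and $x_k$ use these arguments). Series: $$f^{(k)}(a,b,c;x)=\prod_{l=1}^{k-1}x_l^{-b_l}\cdot x_k^{\sum_{l=1}^{k-1}b_l-c+1}\sum_{n_1,\dots,n_m\ge0}\frac{1}{\Gamma^{(k)}_{n_1,\dots,n_m}(a,b,c)}\prod_{l=1}^{k-1}\Big(\frac{x_k}{x_l}\Big)^{n_l}x_k^{n_k}\prod_{l=k+1}^m\Big(\frac{x_l}{x_k}\Big)^{n_l},$$ $\Gamma^{(k)}_{n_1,\dots,n_m}(a,b,c)=\Gamma(c-a-n_k)\prod_{1\le l\le m,\,l\ne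 k}\Gamma(1-b_l-n_l)\prod_{l=1}^m\Gamma(1+n_l)\cdot\Gamma\big(-\sum_{l=1}^kb_l+c-\sum_{l=1}^kn_l+\sum_{l=k+1}^mn_l\big)\cdot\Gamma\big(2+\sum_{l=1}^{k-1}b_l-c+\sum_{l=1}^kn_l-\sum_{l=k+1}^mn_l\big)$ (with $1/\Gamma$ understood as an entire function). Cycle: let $S_x=\mathbb{C}\setminus\{\frac{x_k}{x_l}\ (l\neq k),\,x_k,0,1\}$ and $v_x(s)=\prod_{l=1}^{k-1}(s-\frac{x_k}{x_l})^{\alpha_l}\cdot(s-x_k)^{\alpha_{m+1}-1}\cdot\prod_{l=k+1}^m(1-\frac{x_l}{x_k}s)^{\alpha_l}\cdot s^{\alpha_{m+2}}(1-s)^{\alpha_k+1}$, where at $x=x^{(k)}$ and $0<s<1$ all bases are positive and the principal branch is used. Let $C_0$ (resp. $C_1$) be the counterclockwise circle of radius $\varepsilon$ centered at $0$ (resp. $1$) with starting point $\varepsilon$ (resp. $1-\varepsilon$), with $v_x$ continued analytically along it from its branch on $[\varepsilon,1-\varepsilon]$. Put $$\tilde r_k=\frac{1}{\prod_{l=1}^{k-1}\lambda_l\cdot\lambda_{m+1}\lambda_{m+2}-1}C_0\otimes v_x+[\varepsilon,1-\varepsilon]\otimes v_x-\frac{1}{\lambda_k-1}C_1\otimes v_x\in H_1(S_x,v_x).$$ Let $\iota:S_x\to T_x$, $s\mapsto t=x_k/s$, and $r_k=\iota_*(\tilde r_k)\in H_1(T_x,u_x)$ (the same combination of the images under $\iota$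 of $C_0,[\varepsilon,1-\varepsilon],C_1$, loaded with $u_x$). The branch of $u_x$ is determined by $\arg x_k=-\pi$: at $x=x^{(k)}$, for $t=x_k/s$ with $s\in[\varepsilon,1-\varepsilon]$, all $t-x_i$ $(0\le i\le m+1)$ have argument $-\pi$; it is continued analytically along $\iota(C_0)$, $\iota(C_1)$. For nearby $x$ the cycle is the one obtained by continuous deformation. The integral $\int_{r_k}u_x\varphi_0$ is the corresponding linear combination of path integrals of the branches of $u_x\varphi_0$. *)

theory Defs
  imports "HOL-Complex_Analysis.Complex_Analysis"
begin

text \<open>
  The parameters b and the variables x are families indexed by 1..m; their values at other indices
  are never used.
\<close>

definition marked_pt :: "nat \<Rightarrow> (nat \<Rightarrow> complex) \<Rightarrow> nat \<Rightarrow> complex" where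
  "marked_pt m x i = (if i = 0 then 0 else if i = m + 1 then 1 else x i)"

definition T_space :: "nat \<Rightarrow> (nat \<Rightarrow> complex) \<Rightarrow> complex set" where
  "T_space m x = - marked_pt m x ` {0..m+1}"

text \<open>The index m + 2 stands for the point at infinity; the exponents add up to 0.\<close>

definition expo :: "nat \<Rightarrow> complex \<Rightarrow> (nat \<Rightarrow> complex) \<Rightarrow> complex \<Rightarrow> nat \<Rightarrow> complex" where
  "expo m a b c i =
     (if i = 0 then - c + (\<Sum>j=1..m. b j)
      else if i \<le> m then - b i
      else if i = m + 1 then c - a
      else a)"

definition lam :: "nat \<Rightarrow> complex \<Rightarrow> (nat \<Rightarrow> complex) \<Rightarrow> complex \<Rightarrow> nat \<Rightarrow> complex" where
  "lam m a b c j = exp (2 * of_real pi * \<i> * expo m a b c j)"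

definition base_pt :: "nat \<Rightarrow> real \<Rightarrow> nat \<Rightarrow> complex" where
  "base_pt k \<xi> l = (if l = k then exp (- (of_real pi * \<i>)) * of_real \<xi> ^ l else of_real \<xi> ^ l)"

text \<open>
  The branch of the logarithm whose imaginary part is \<open>\<theta>\<close> on the ray of argument \<open>\<theta>\<close>, cut along the
  opposite ray. Prescribing \<open>arg z\<^sub>0 = \<theta>\<close> and extending continuously to z near \<open>z\<^sub>0\<close> gives this branch.
\<close>

definition Ln_at :: "real \<Rightarrow> complex \<Rightarrow> complex" where
  "Ln_at \<theta> z = Ln (z * cis (- \<theta>)) + \<i> * of_real \<theta>"

definition powr_at :: "real \<Rightarrow> complex \<Rightarrow> complex \<Rightarrow> complex" where
  "powr_at \<theta> z p = exp (p * Ln_at \<theta> z)"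

text \<open>A continuous logarithm along a path is determined on the unit interval by its initial value.\<close>

definition is_log_along :: "(real \<Rightarrow> complex) \<Rightarrow> (real \<Rightarrow> complex) \<Rightarrow> bool" where
  "is_log_along \<gamma> L \<longleftrightarrow> continuous_on {0..1} L \<and> (\<forall>\<tau>\<in>{0..1}. exp (L \<tau>) = \<gamma> \<tau>)"

definition continued_log :: "(real \<Rightarrow> complex) \<Rightarrow> complex \<Rightarrow> real \<Rightarrow> complex" where
  "continued_log \<gamma> w = (SOME L. is_log_along \<gamma> L \<and> L 0 = w)"

definition is_u_branch ::
  "nat \<Rightarrow> complex \<Rightarrow> (nat \<Rightarrow> complex) \<Rightarrow> complex \<Rightarrow> (nat \<Rightarrow> complex) \<Rightarrow>
   (real \<Rightarrow> complex) \<Rightarrow> (real \<Rightarrow> complex) \<Rightarrow> bool" where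
  "is_u_branch m a b c x \<gamma> u \<longleftrightarrow>
     (\<exists>L. (\<forall>i\<le>m+1. is_log_along (\<lambda>\<tau>. \<gamma> \<tau> - marked_pt m x i) (L i)) \<and>
          (\<forall>\<tau>\<in>{0..1}. u \<tau> = (\<Prod>i=0..m+1. exp (expo m a b c i * L i \<tau>))))"

text \<open>
  The branch of u along a path which starts where every factor has its argument near \<open>\<theta>\<close>
  (equal to \<open>\<theta>\<close> at the base point), continued analytically along the path.
\<close>

definition u_along ::
  "real \<Rightarrow> nat \<Rightarrow> complex \<Rightarrow> (nat \<Rightarrow> complex) \<Rightarrow> complex \<Rightarrow> (nat \<Rightarrow> complex) \<Rightarrow>
   (real \<Rightarrow> complex) \<Rightarrow> real \<Rightarrow> complex" where
  "u_along \<theta> m a b c x \<gamma> \<tau> =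
     (\<Prod>i=0..m+1. exp (expo m a b c i *
        continued_log (\<lambda>\<sigma>. \<gamma> \<sigma> - marked_pt m x i) (Ln_at \<theta> (\<gamma> 0 - marked_pt m x i)) \<tau>))"

text \<open>
  A loaded 1-chain is a formal combination of triples: coefficient, path, and branch of u along
  the path. A loaded 0-chain is represented by the function that sends a point to the value there
  of the branch it carries; this is faithful because the branches of u at a point form a line and
  do not vanish.
\<close>

type_synonym loaded_chain = "(complex \<times> (real \<Rightarrow> complex) \<times> (real \<Rightarrow> complex)) list"

definition loaded_boundary :: "loaded_chain \<Rightarrow> complex \<Rightarrow> complex" where
  "loaded_boundary C z =
     (\<Sum>(q, \<gamma>, u)\<leftarrow>C. q * ((if pathfinish \<gamma> = z then u 1 else 0) - (if pathstart \<gamma> = z then u 0 else 0)))"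

definition is_twisted_cycle ::
  "nat \<Rightarrow> complex \<Rightarrow> (nat \<Rightarrow> complex) \<Rightarrow> complex \<Rightarrow> (nat \<Rightarrow> complex) \<Rightarrow> loaded_chain \<Rightarrow> bool" where
  "is_twisted_cycle m a b c x C \<longleftrightarrow>
     (\<forall>(q, \<gamma>, u)\<in>set C. path \<gamma> \<and> path_image \<gamma> \<subseteq> T_space m x \<and> is_u_branch m a b c x \<gamma> u) \<and>
     (\<forall>z. loaded_boundary C z = 0)"

text \<open>The integral of the multivalued form with coefficient function \<open>\<phi>\<close>, i.e. of \<open>u \<phi>(t) dt\<close>.\<close>

definition loaded_integral :: "loaded_chain \<Rightarrow> (complex \<Rightarrow> complex) \<Rightarrow> complex" where
  "loaded_integral C \<phi> =
     (\<Sum>(q, \<gamma>, u)\<leftarrow>C. q * integral {0..1}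
        (\<lambda>\<tau>. u \<tau> * \<phi> (\<gamma> \<tau>) * vector_derivative \<gamma> (at \<tau> within {0..1})))"

text \<open>
  The coefficients and underlying paths of the cycle in the s-plane. The second circle runs over
  the angles from \<open>\<pi>\<close> to \<open>3\<pi>\<close>, so that it starts at \<open>1 - \<epsilon>\<close>.
\<close>

definition s_cycle ::
  "nat \<Rightarrow> complex \<Rightarrow> (nat \<Rightarrow> complex) \<Rightarrow> complex \<Rightarrow> nat \<Rightarrow> real \<Rightarrow> (complex \<times> (real \<Rightarrow> complex)) list" where
  "s_cycle m a b c k \<epsilon> =
     [(1 / ((\<Prod>l=1..k-1. lam m a b c l) * lam m a b c (m+1) * lam m a b c (m+2) - 1),
         circlepath 0 \<epsilon>),
      (1, linepath (of_real \<epsilon>) (of_real (1 - \<epsilon>))),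
      (- 1 / (lam m a b c k - 1), part_circlepath 1 \<epsilon> pi (3 * pi))]"

text \<open>
  Its push-forward under \<open>s \<mapsto> x\<^sub>k / s\<close>, loaded with the branch of u for which every
  \<open>t - x\<^sub>i\<close> has argument \<open>-\<pi>\<close> on the image of \<open>[\<epsilon>, 1 - \<epsilon>]\<close> at the base point. Each of the three
  paths starts on that image.
\<close>

definition r_cycle ::
  "nat \<Rightarrow> complex \<Rightarrow> (nat \<Rightarrow> complex) \<Rightarrow> complex \<Rightarrow> nat \<Rightarrow> real \<Rightarrow> (nat \<Rightarrow> complex) \<Rightarrow> loaded_chain" where
  "r_cycle m a b c k \<epsilon> x =
     map (\<lambda>(q, \<sigma>). let \<gamma> = (\<lambda>\<tau>. x k / \<sigma> \<tau>) in (q, \<gamma>, u_along (- pi) m a b c x \<gamma>))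
       (s_cycle m a b c k \<epsilon>)"

definition phi0 :: "complex \<Rightarrow> complex" where
  "phi0 t = 1 / (t - 1)"

definition rGamma_coeff ::
  "nat \<Rightarrow> nat \<Rightarrow> complex \<Rightarrow> (nat \<Rightarrow> complex) \<Rightarrow> complex \<Rightarrow> (nat \<Rightarrow> nat) \<Rightarrow> complex" where
  "rGamma_coeff m k a b c n =
     rGamma (c - a - of_nat (n k)) *
     (\<Prod>l\<in>{1..m} - {k}. rGamma (1 - b l - of_nat (n l))) *
     (\<Prod>l=1..m. rGamma (1 + of_nat (n l))) *
     rGamma (- (\<Sum>l=1..k. b l) + c - (\<Sum>l=1..k. of_nat (n l)) + (\<Sum>l=k+1..m. of_nat (n l))) *
     rGamma (2 + (\<Sum>l=1..k-1. b l) - c + (\<Sum>l=1..k. of_nat (n l)) - (\<Sum>l=k+1..m. of_nat (n l)))"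

definition f_term ::
  "nat \<Rightarrow> nat \<Rightarrow> complex \<Rightarrow> (nat \<Rightarrow> complex) \<Rightarrow> complex \<Rightarrow> (nat \<Rightarrow> complex) \<Rightarrow> (nat \<Rightarrow> nat) \<Rightarrow> complex" where
  "f_term m k a b c x n =
     rGamma_coeff m k a b c n *
     (\<Prod>l=1..k-1. (x k / x l) ^ n l) * x k ^ n k * (\<Prod>l=k+1..m. (x l / x k) ^ n l)"

definition multi_indices :: "nat \<Rightarrow> (nat \<Rightarrow> nat) set" where
  "multi_indices m = {1..m} \<rightarrow>\<^sub>E UNIV"

text \<open>The arguments are near 0 for \<open>x\<^sub>l\<close> with \<open>l < k\<close> (principal powers) and near \<open>-\<pi>\<close> for \<open>x\<^sub>k\<close>.\<close>

definition f_series ::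
  "nat \<Rightarrow> nat \<Rightarrow> complex \<Rightarrow> (nat \<Rightarrow> complex) \<Rightarrow> complex \<Rightarrow> (nat \<Rightarrow> complex) \<Rightarrow> complex" where
  "f_series m k a b c x =
     (\<Prod>l=1..k-1. x l powr (- b l)) *
     powr_at (- pi) (x k) ((\<Sum>l=1..k-1. b l) - c + 1) *
     (\<Sum>\<^sub>\<infinity>n\<in>multi_indices m. f_term m k a b c x n)"

end

theory Submission
  imports Defs
begin

text \<open>
  After the substitution t = x k / s every factor of u has an explicit continuous logarithm along
  the three paths, built from logarithms of s and of 1 - s and from principal logarithms of
  1 - w with |w| < 1. Pulling out the constants leaves a power of s, a power of 1 - s and m binomial
  factors (1 - w) powr e, which are expanded and integrated termwise. Each term is a beta integral over
  the regularised cycle. That integral equals the Beta function: for real parameters between 0 and 1 the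
  circle around 0 contributes the integral over [0, \<epsilon>], as the primitive of the integrand near 0 is
  s powr p times a holomorphic function, and the identity theorem in each parameter does the rest.
  The reflection formula turns the resulting Gamma quotients into the coefficients of the series.
\<close>

section \<open>The regularised beta integral\<close>

text \<open>A multi-index changes the exponent of s only by an integer, so all terms of the
  expansion have the same monodromy around 0, and likewise around 1. This is why one cycle, with
  coefficients independent of the multi-index, regularises all the beta integrals at once. Plain
  integrals over [0, 1] would not do: the indices up to k lower the exponent at 0 without bound, so
  for any parameters infinitely many terms would diverge. The constants reflect geometry: the three
  paths stay in the annulus \<epsilon> \<le> |s| \<le> 1 + \<epsilon>, and \<xi> < \<epsilon>
  together with \<xi> < 1 / (1 + \<epsilon>) makes the expansions in x_k / (x_l s), x_k / s and x_l
  s / x_k converge uniformly there. The exponential in the formula collects the argument -pi from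
  the factors t - x_l with l < k and t - 1, which are written as -x_l (1 - w) and -(1 - w).\<close>

text \<open>The logarithm of s continued along the circle of radius \<epsilon> around 0. It ends 2
  pi i above its start, whereas the principal logarithm would jump.\<close>

definition loop_log :: "real \<Rightarrow> real \<Rightarrow> complex" where
  "loop_log \<epsilon> \<tau> = of_real (ln \<epsilon>) + 2 * of_real pi * \<i> * of_real \<tau>"

text \<open>The real logarithm of s on [\<epsilon>, 1 - \<epsilon>]. The segment is symmetric about
  1/2, so reversing the parameter gives the logarithm of 1 - s.\<close>

definition seg_log :: "real \<Rightarrow> real \<Rightarrow> complex" where
  "seg_log \<epsilon> \<tau> = of_real (ln (\<epsilon> + \<tau> * (1 - 2 * \<epsilon>)))"

text \<open>The integral of \<open>s^(p-1) (1-s)^(q-1) ds\<close> along a path, with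
  \<open>A\<close> and \<open>B\<close> as logarithms of s and 1 - s and \<open>d\<close> as
  velocity. Taking the logarithms as data fixes the branch and makes the integrand entire in
  \<open>p\<close> and \<open>q\<close>.\<close>

definition beta_integral ::
  "(real \<Rightarrow> complex) \<Rightarrow> (real \<Rightarrow> complex) \<Rightarrow> (real \<Rightarrow> complex) \<Rightarrow> complex \<Rightarrow> complex \<Rightarrow> complex" where
  "beta_integral A B d p q =
     integral {0..1} (\<lambda>\<tau>. exp ((p - 1) * A \<tau>) * exp ((q - 1) * B \<tau>) * d \<tau>)"

definition loop_beta :: "real \<Rightarrow> complex \<Rightarrow> complex \<Rightarrow> complex" where
  "loop_beta \<epsilon> = beta_integral (loop_log \<epsilon>) (\<lambda>\<tau>. Ln (1 - exp (loop_log \<epsilon> \<tau>)))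
     (\<lambda>\<tau>. 2 * of_real pi * \<i> * exp (loop_log \<epsilon> \<tau>))"

definition seg_beta :: "real \<Rightarrow> complex \<Rightarrow> complex \<Rightarrow> complex" where
  "seg_beta \<epsilon> = beta_integral (seg_log \<epsilon>) (\<lambda>\<tau>. seg_log \<epsilon> (1 - \<tau>)) (\<lambda>\<tau>. 1 - 2 * of_real \<epsilon>)"

text \<open>In the last term the circle around 1 is carried to the circle around 0 by s -> 1 - s.
  This exchanges the parameters and reverses the velocity, which turns the coefficient -1 /
  (\<lambda> - 1) of the cycle into a positive one.\<close>

definition reg_beta :: "real \<Rightarrow> complex \<Rightarrow> complex \<Rightarrow> complex" where
  "reg_beta \<epsilon> p q =
     loop_beta \<epsilon> p q / (exp (2 * of_real pi * \<i> * p) - 1) + seg_beta \<epsilon> p q +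
     loop_beta \<epsilon> q p / (exp (2 * of_real pi * \<i> * q) - 1)"

lemma norm_exp_loop_log:
  assumes "0 < \<epsilon>"
  shows "norm (exp (loop_log \<epsilon> \<tau>)) = \<epsilon>"
  using assms by (simp add: loop_log_def)

lemma loop_log_deriv:
  "(loop_log \<epsilon> has_vector_derivative 2 * of_real pi * \<i>) (at \<tau> within S)"
  unfolding loop_log_def
  by (auto intro!: derivative_eq_intros has_vector_derivative_real_field)

lemma continuous_loop_log: "continuous_on S (loop_log \<epsilon>)"
  unfolding loop_log_def by (intro continuous_intros)

lemma one_minus_not_nonpos:
  fixes z :: complex
  assumes "norm z < 1"
  shows "1 - z \<notin> \<real>\<^sub>\<le>\<^sub>0"
proof
  assume "1 - z \<in> \<real>\<^sub>\<le>\<^sub>0"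
  then have "Re (1 - z) \<le> 0" by (auto simp: complex_nonpos_Reals_iff)
  then show False using complex_Re_le_cmod[of z] assms by simp
qed

lemma one_minus_nonzero:
  fixes z :: complex
  assumes "norm z < 1"
  shows "1 - z \<noteq> 0"
  using assms by auto

lemma continuous_Ln_one_minus:
  assumes "continuous_on S f" "\<And>t. t \<in> S \<Longrightarrow> norm (f t) < 1"
  shows "continuous_on S (\<lambda>t. Ln (1 - f t))"
  using assms one_minus_not_nonpos by (intro continuous_intros) auto

lemma continuous_seg_log:
  assumes "0 < \<epsilon>" "\<epsilon> < 1/2"
  shows "continuous_on {0..1} (seg_log \<epsilon>)" "continuous_on {0..1} (\<lambda>\<tau>. seg_log \<epsilon> (1 - \<tau>))"
proof -
  have pos: "\<epsilon> + \<tau> * (1 - 2 * \<epsilon>) > 0" if "0 \<le> \<tau>" for \<tau>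
    using assms that by (intro add_pos_nonneg mult_nonneg_nonneg) auto
  show "continuous_on {0..1} (seg_log \<epsilon>)"
    unfolding seg_log_def using pos by (intro continuous_intros) (auto simp: less_imp_neq[symmetric])
  show "continuous_on {0..1} (\<lambda>\<tau>. seg_log \<epsilon> (1 - \<tau>))"
    unfolding seg_log_def by (intro continuous_intros ballI less_imp_neq[THEN not_sym] pos) auto
qed

lemma beta_integral_commute: "beta_integral A B d p q = beta_integral B A d q p"
  unfolding beta_integral_def by (simp add: mult_ac)

text \<open>The paths are compact and the logarithms do not depend on \<open>p\<close>, so one may
  differentiate under the integral sign with no convergence condition on \<open>p\<close> or
  \<open>q\<close>. Holomorphy in \<open>q\<close> then follows from
  \<open>beta_integral_commute\<close>.\<close>

lemma holomorphic_beta_integral: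
  assumes "continuous_on {0..1} A" "continuous_on {0..1} B" "continuous_on {0..1} d"
  shows "(\<lambda>p. beta_integral A B d p q) holomorphic_on UNIV"
proof -
  have "(\<lambda>p. integral (cbox 0 1) (\<lambda>\<tau>. exp ((p - 1) * A \<tau>) * exp ((q - 1) * B \<tau>) * d \<tau>)) holomorphic_on UNIV"
  proof (rule leibniz_rule_holomorphic)
    show "((\<lambda>p. exp ((p - 1) * A t) * exp ((q - 1) * B t) * d t) has_field_derivative
            A t * exp ((p - 1) * A t) * exp ((q - 1) * B t) * d t) (at p within UNIV)" for p t
      by (auto intro!: derivative_eq_intros)
    show "(\<lambda>\<tau>. exp ((p - 1) * A \<tau>) * exp ((q - 1) * B \<tau>) * d \<tau>) integrable_on cbox 0 1" for p
      using assms by (intro integrable_continuous continuous_intros) auto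
    have "continuous_on (UNIV \<times> cbox 0 1) (\<lambda>x. f (snd x))" if "continuous_on {0..1} f"
      for f :: "real \<Rightarrow> complex"
      by (rule continuous_on_compose2[OF that]) (auto intro!: continuous_intros)
    note this[OF assms(1)] this[OF assms(2)] this[OF assms(3)]
    then show "continuous_on (UNIV \<times> cbox 0 1)
        (\<lambda>(p, t). A t * exp ((p - 1) * A t) * exp ((q - 1) * B t) * d t)"
      unfolding case_prod_beta by (intro continuous_intros)
  qed auto
  then show ?thesis by (simp add: beta_integral_def)
qed

lemma continuous_loop_data:
  assumes "0 < \<epsilon>" "\<epsilon> < 1"
  shows "continuous_on {0..1} (\<lambda>\<tau>. Ln (1 - exp (loop_log \<epsilon> \<tau>)))"
        "continuous_on {0..1} (\<lambda>\<tau>. 2 * of_real pi * \<i> * exp (loop_log \<epsilon> \<tau>))"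
  using assms
  by (intro continuous_Ln_one_minus continuous_intros continuous_loop_log;
      simp add: norm_exp_loop_log del: norm_exp_eq_Re)+

lemma exp_two_pi_i_neq_1:
  assumes "p \<notin> \<int>"
  shows "exp (2 * of_real pi * \<i> * p) - 1 \<noteq> 0"
proof
  assume "exp (2 * of_real pi * \<i> * p) - 1 = 0"
  then have "exp (2 * of_real pi * \<i> * p) = 1" by simp
  then obtain n :: int where n: "Re (2 * of_real pi * \<i> * p) = 0" "Im (2 * of_real pi * \<i> * p) = of_int (2 * n) * pi"
    by (auto simp: exp_eq_1)
  then have "p = of_int n" by (auto simp: complex_eq_iff)
  then show False using assms by simp
qed

lemma holomorphic_reg_beta:
  assumes "0 < \<epsilon>" "\<epsilon> < 1/2"
  shows "(\<lambda>p. reg_beta \<epsilon> p q) holomorphic_on - \<int>" "(\<lambda>q. reg_beta \<epsilon> p q) holomorphic_on - \<int>"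
proof -
  note cont = continuous_loop_log[of "{0..1}"] continuous_loop_data[of \<epsilon>] continuous_seg_log[of \<epsilon>]
  note ne = exp_two_pi_i_neq_1
  have hol: "(\<lambda>p. beta_integral A B d p q) holomorphic_on - \<int>" "(\<lambda>q. beta_integral A B d p q) holomorphic_on - \<int>"
    if "continuous_on {0..1} A" "continuous_on {0..1} B" "continuous_on {0..1} d" for A B d p q
    using holomorphic_on_subset[OF holomorphic_beta_integral[OF that]]
      holomorphic_on_subset[OF holomorphic_beta_integral[OF that(2,1,3)]]
    by (auto simp: beta_integral_commute[of A B])
  have h1: "(\<lambda>p. loop_beta \<epsilon> p q) holomorphic_on - \<int>" "(\<lambda>q. loop_beta \<epsilon> p q) holomorphic_on - \<int>"
    "(\<lambda>p. seg_beta \<epsilon> p q) holomorphic_on - \<int>" "(\<lambda>q. seg_beta \<epsilon> p q) holomorphic_on - \<int>" for p q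
    unfolding loop_beta_def seg_beta_def
    using assms by (intro hol cont continuous_on_const; simp)+
  show "(\<lambda>p. reg_beta \<epsilon> p q) holomorphic_on - \<int>" "(\<lambda>q. reg_beta \<epsilon> p q) holomorphic_on - \<int>"
    unfolding reg_beta_def using ne by (intro holomorphic_intros h1; simp)+
qed

text \<open>The equation says that \<open>z^p * h z\<close> is a primitive of
  \<open>z^(p-1) * (1-z)^a\<close>. Dividing the n-th binomial coefficient by p + n solves it with a
  power series, so all multivaluedness sits in \<open>z^p\<close>.\<close>

lemma binomial_primitive:
  fixes p :: real and a :: complex
  assumes "0 < p"
  shows "\<exists>h h'. \<forall>z::complex. norm z < 1 \<longrightarrow>
    (h has_field_derivative h' z) (at z) \<and> of_real p * h z + z * h' z = (1 - z) powr a"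
proof -
  define c where "c n = (a gchoose n) * (-1) ^ n" for n
  define d where "d n = c n / (of_real p + of_nat n)" for n
  have nz: "of_real p + of_nat n \<noteq> (0::complex)" for n
    using assms by (metis add_pos_nonneg of_nat_0_le_iff of_real_add of_real_eq_0_iff of_real_of_nat_eq less_irrefl)
  have c: "(\<lambda>n. c n * z ^ n) sums (1 - z) powr a" if "norm z < 1" for z
    using gen_binomial_complex[of "- z" a] that by (simp add: c_def power_minus[of z] mult_ac)
  have d: "summable (\<lambda>n. d n * z ^ n)" if "norm z < 1" for z
  proof -
    \<comment> \<open>A point strictly between \<open>norm z\<close> and the unit circle:
      convergence there gives absolute convergence at \<open>z\<close>.\<close>
    define w :: complex where "w = of_real ((norm z + 1) / 2)"
    have "norm w = (norm z + 1) / 2" unfolding w_def norm_of_real by simp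
    with that have w: "norm z < norm w" "norm w < 1" by auto
    have "summable (\<lambda>n. norm (c n * z ^ n))"
      using powser_insidea[OF sums_summable[OF c[OF w(2)]] w(1)] .
    then have s: "summable (\<lambda>n. norm (c n * z ^ n) / p)" by (rule summable_divide)
    have "norm (d n * z ^ n) \<le> norm (c n * z ^ n) / p" for n
    proof -
      have "norm (complex_of_real p + of_nat n) = p + of_nat n"
        using assms by (metis abs_of_nonneg add_nonneg_nonneg less_imp_le norm_of_real of_nat_0_le_iff of_real_add of_real_of_nat_eq)
      then show ?thesis using assms
        by (auto simp: d_def norm_mult norm_divide intro!: divide_left_mono mult_nonneg_nonneg mult_pos_pos)
    qed
    then show ?thesis by (intro summable_comparison_test'[OF s]) auto
  qed
  define h where "h z = (\<Sum>n. d n * z ^ n)" for z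
  define h' where "h' z = (\<Sum>n. diffs d n * z ^ n)" for z
  show ?thesis
  proof (intro exI allI impI conjI)
    fix z :: complex assume z: "norm z < 1"
    show D: "(h has_field_derivative h' z) (at z)"
      unfolding h_def h'_def by (rule termdiffs_strong'[of 1]) (use d z in auto)
    have "(\<lambda>n. diffs d n * z ^ n) sums h' z"
      by (rule termdiffs_sums_strong[of 1 d h]) (use d z D in \<open>auto simp: h_def summable_sums\<close>)
    then have "(\<lambda>n. z * (diffs d n * z ^ n)) sums (z * h' z)" by (rule sums_mult)
    then have "(\<lambda>n. of_nat (Suc n) * d (Suc n) * z ^ Suc n) sums (z * h' z)"
      by (simp add: diffs_def mult_ac)
    then have "(\<lambda>n. of_nat n * d n * z ^ n) sums (z * h' z)" 
      using sums_Suc[of "\<lambda>n. of_nat n * d n * z ^ n" "z * h' z"] by simp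
    moreover have "(\<lambda>n. of_real p * (d n * z ^ n)) sums (of_real p * h z)"
      unfolding h_def by (intro sums_mult summable_sums d z)
    ultimately have "(\<lambda>n. of_real p * (d n * z ^ n) + of_nat n * d n * z ^ n) sums (of_real p * h z + z * h' z)"
      by (intro sums_add)
    also have "(\<lambda>n. of_real p * (d n * z ^ n) + of_nat n * d n * z ^ n) = (\<lambda>n. c n * z ^ n)"
    proof
      fix n
      have "of_real p * (d n * z ^ n) + of_nat n * d n * z ^ n = ((of_real p + of_nat n) * d n) * z ^ n"
        by (simp add: algebra_simps)
      then show "of_real p * (d n * z ^ n) + of_nat n * d n * z ^ n = c n * z ^ n"
        using nz[of n] by (simp add: d_def)
    qed
    finally show "of_real p * h z + z * h' z = (1 - z) powr a"
      using c[OF z] sums_unique2 by blast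
  qed
qed

text \<open>Both integrals are evaluated with the primitive \<open>s^p * h s\<close>. On
  [0, \<epsilon>] it vanishes at 0 because p > 0; around the loop \<open>h\<close> returns to its
  value while \<open>s^p\<close> picks up the factor \<open>exp (2 pi i p)\<close>.\<close>

lemma loop_beta_real:
  fixes p q :: real
  assumes p: "0 < p" and e: "0 < \<epsilon>" "\<epsilon> < 1"
  shows "\<exists>I. ((\<lambda>t. of_real (t powr (p - 1) * (1 - t) powr (q - 1))) has_integral I) {0..\<epsilon>} \<and>
    loop_beta \<epsilon> (of_real p) (of_real q) = (exp (2 * of_real pi * \<i> * of_real p) - 1) * I"
proof -
  obtain h h' :: "complex \<Rightarrow> complex" where h: "\<And>z. norm z < 1 \<Longrightarrow> (h has_field_derivative h' z) (at z)"
    "\<And>z. norm z < 1 \<Longrightarrow> of_real p * h z + z * h' z = (1 - z) powr (of_real (q - 1))"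
    using binomial_primitive[OF p, of "of_real (q - 1)"] by blast
  define I where "I = of_real (\<epsilon> powr p) * h (of_real \<epsilon>)"
  have contp: "continuous_on {0..\<epsilon>} (\<lambda>t. t powr p)"
    by (rule continuous_on_powr') (use p in \<open>auto intro!: continuous_intros\<close>)
  have conth: "continuous_on {0..\<epsilon>} (\<lambda>t. h (of_real t))"
  proof (rule continuous_on_compose2[of "ball 0 1" h])
    show "continuous_on (ball 0 1) h"
      using h(1) by (intro DERIV_continuous_on) (auto intro: has_field_derivative_at_within)
  qed (use e in \<open>auto intro!: continuous_intros\<close>)
  \<comment> \<open>The fundamental theorem is used in its interior form, since for p < 1 the factor
    \<open>t powr p\<close> is continuous at 0 but not differentiable there.\<close>
  have "((\<lambda>t. of_real (t powr (p - 1) * (1 - t) powr (q - 1))) has_integral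
     (of_real (\<epsilon> powr p) * h (of_real \<epsilon>) - of_real (0 powr p) * h (of_real 0))) {0..\<epsilon>}"
  proof (rule fundamental_theorem_of_calculus_interior)
    show "continuous_on {0..\<epsilon>} (\<lambda>t. of_real (t powr p) * h (of_real t))"
      by (intro continuous_intros contp conth)
    fix t assume t: "t \<in> {0<..<\<epsilon>}"
    then have t1: "norm (complex_of_real t) < 1" using e by simp
    have d1: "((\<lambda>t. complex_of_real (t powr p)) has_vector_derivative of_real (p * t powr (p - 1))) (at t)"
    proof -
      have "((\<lambda>t. t powr p) has_real_derivative p * t powr (p - 1)) (at t)"
        using t by (auto intro!: derivative_eq_intros)
      then show ?thesis
        by (intro has_vector_derivative_of_real) (simp add: has_real_derivative_iff_has_vector_derivative)
    qed
    have d2: "((\<lambda>t. h (of_real t)) has_vector_derivative h' (of_real t)) (at t)"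
      using has_vector_derivative_real_field[OF h(1)[OF t1]] by (simp add: o_def)
    have e1: "t powr p = t powr (p - 1) * t" using t by (simp add: powr_diff)
    have e2: "(1 - of_real t) powr (of_real (q - 1)) = complex_of_real ((1 - t) powr (q - 1))"
      using powr_of_real[of "1 - t" "q - 1"] t e by simp
    have "((\<lambda>t. of_real (t powr p) * h (of_real t)) has_vector_derivative
       of_real (t powr p) * h' (of_real t) + of_real (p * t powr (p - 1)) * h (of_real t)) (at t)"
      by (rule has_vector_derivative_mult[OF d1 d2])
    also have "of_real (t powr p) * h' (of_real t) + of_real (p * t powr (p - 1)) * h (of_real t) =
       of_real (t powr (p - 1)) * (of_real p * h (of_real t) + of_real t * h' (of_real t))"
      by (simp add: e1 algebra_simps)
    finally show "((\<lambda>t. of_real (t powr p) * h (of_real t)) has_vector_derivative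
       of_real (t powr (p - 1) * (1 - t) powr (q - 1))) (at t)"
      using h(2)[OF t1] e2 by simp
  qed (use e in auto)
  then have 1: "((\<lambda>t. of_real (t powr (p - 1) * (1 - t) powr (q - 1))) has_integral I) {0..\<epsilon>}"
    using p by (simp add: I_def)
  \<comment> \<open>The same primitive in the coordinate w = log s, where it is single-valued and
    the loop becomes a straight segment of length 2 pi.\<close>
  define F where "F \<tau> = exp (of_real p * loop_log \<epsilon> \<tau>) * h (exp (loop_log \<epsilon> \<tau>))" for \<tau>
  have "((\<lambda>\<tau>. exp ((of_real p - 1) * loop_log \<epsilon> \<tau>) * exp ((of_real q - 1) * Ln (1 - exp (loop_log \<epsilon> \<tau>))) *
          (2 * of_real pi * \<i> * exp (loop_log \<epsilon> \<tau>))) has_integral (F 1 - F 0)) {0..1}"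
  proof (rule fundamental_theorem_of_calculus)
    fix \<tau> :: real
    have n1: "norm (exp (loop_log \<epsilon> \<tau>)) < 1" using norm_exp_loop_log e by simp
    let ?w = "loop_log \<epsilon> \<tau>"
    have d1: "((\<lambda>w. exp (of_real p * w)) has_field_derivative of_real p * exp (of_real p * ?w)) (at ?w)"
      by (auto intro!: derivative_eq_intros)
    have d2: "((\<lambda>w. h (exp w)) has_field_derivative h' (exp ?w) * exp ?w) (at ?w)"
      by (rule DERIV_chain2[OF h(1)[OF n1] DERIV_exp])
    have "((\<lambda>w. exp (of_real p * w) * h (exp w)) has_field_derivative
        (of_real p * exp (of_real p * ?w) * h (exp ?w) + exp (of_real p * ?w) * (h' (exp ?w) * exp ?w))) (at ?w)"
      using DERIV_mult[OF d1 d2] by (simp add: algebra_simps)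
    from field_vector_diff_chain_at[OF loop_log_deriv this]
    have "(F has_vector_derivative 2 * of_real pi * \<i> *
        (of_real p * exp (of_real p * ?w) * h (exp ?w) + exp (of_real p * ?w) * (h' (exp ?w) * exp ?w))) (at \<tau>)"
      by (simp add: o_def F_def[abs_def])
    also have "2 * of_real pi * \<i> *
        (of_real p * exp (of_real p * ?w) * h (exp ?w) + exp (of_real p * ?w) * (h' (exp ?w) * exp ?w)) =
       2 * of_real pi * \<i> * exp (of_real p * ?w) * (of_real p * h (exp ?w) + exp ?w * h' (exp ?w))"
      by (simp add: algebra_simps)
    also have "\<dots> = 2 * of_real pi * \<i> * exp (of_real p * ?w) * exp ((of_real q - 1) * Ln (1 - exp ?w))"
    proof -
      have "1 - exp ?w \<noteq> 0" by (rule one_minus_nonzero[OF n1])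
      then have "(1 - exp ?w) powr of_real (q - 1) = exp ((of_real q - 1) * Ln (1 - exp ?w))"
        by (simp only: powr_def if_False of_real_diff of_real_1)
      then show ?thesis by (simp only: h(2)[OF n1])
    qed
    also have "\<dots> = exp ((of_real p - 1) * ?w) * exp ((of_real q - 1) * Ln (1 - exp ?w)) *
          (2 * of_real pi * \<i> * exp ?w)"
    proof -
      have "exp (of_real p * ?w) = exp ((of_real p - 1) * ?w) * exp ?w"
        unfolding exp_add[symmetric] by (simp add: algebra_simps)
      then show ?thesis by (simp only: mult_ac)
    qed
    finally show "(F has_vector_derivative exp ((of_real p - 1) * loop_log \<epsilon> \<tau>) * exp ((of_real q - 1) * Ln (1 - exp (loop_log \<epsilon> \<tau>))) *
          (2 * of_real pi * \<i> * exp (loop_log \<epsilon> \<tau>))) (at \<tau> within {0..1})"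
      by (rule has_vector_derivative_at_within)
  qed auto
  then have "loop_beta \<epsilon> (of_real p) (of_real q) = F 1 - F 0"
    unfolding loop_beta_def beta_integral_def by (rule integral_unique)
  also have "F 1 - F 0 = (exp (2 * of_real pi * \<i> * of_real p) - 1) * I"
  proof -
    have a: "exp (of_real p * of_real (ln \<epsilon>)) = complex_of_real (\<epsilon> powr p)"
      using e by (simp add: powr_def exp_of_real[symmetric])
    have b: "exp (loop_log \<epsilon> 1) = of_real \<epsilon>" "exp (loop_log \<epsilon> 0) = of_real \<epsilon>"
      using e by (simp_all add: loop_log_def exp_add exp_of_real)
    have c: "exp (of_real p * loop_log \<epsilon> 1) = of_real (\<epsilon> powr p) * exp (2 * of_real pi * \<i> * of_real p)"
      unfolding a[symmetric] exp_add[symmetric] by (simp add: loop_log_def algebra_simps)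
    show ?thesis by (simp add: F_def b c I_def) (simp add: loop_log_def a algebra_simps)
  qed
  finally show ?thesis using 1 by blast
qed

lemma has_integral_seg_beta:
  fixes p q :: real
  assumes e: "0 < \<epsilon>" "\<epsilon> < 1/2"
  shows "((\<lambda>t. of_real (t powr (p - 1) * (1 - t) powr (q - 1))) has_integral
           seg_beta \<epsilon> (of_real p) (of_real q)) {\<epsilon>..1 - \<epsilon>}"
proof -
  define f where "f t = complex_of_real (t powr (p - 1) * (1 - t) powr (q - 1))" for t
  have "continuous_on {\<epsilon>..1 - \<epsilon>} f"
    unfolding f_def using e by (intro continuous_intros) auto
  then have int: "(f has_integral integral {\<epsilon>..1 - \<epsilon>} f) {\<epsilon>..1 - \<epsilon>}"
    by (intro integrable_integral integrable_continuous_real)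
  have "((\<lambda>\<tau>. (1 - 2 * \<epsilon>) *\<^sub>R f (\<epsilon> + \<tau> * (1 - 2 * \<epsilon>))) has_integral
     (integral {\<epsilon> + 0 * (1 - 2 * \<epsilon>)..\<epsilon> + 1 * (1 - 2 * \<epsilon>)} f)) {0..1}"
  proof (rule has_integral_substitution[of 0 1 _ \<epsilon> "1 - \<epsilon>"])
    show "(\<lambda>\<tau>. \<epsilon> + \<tau> * (1 - 2 * \<epsilon>)) ` {0..1} \<subseteq> {\<epsilon>..1 - \<epsilon>}"
    proof safe
      fix \<tau> :: real assume t: "\<tau> \<in> {0..1}"
      have "0 \<le> \<tau> * (1 - 2 * \<epsilon>)" using t e by auto
      moreover have "\<tau> * (1 - 2 * \<epsilon>) \<le> 1 * (1 - 2 * \<epsilon>)" using t e by (intro mult_right_mono) auto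
      ultimately show "\<epsilon> + \<tau> * (1 - 2 * \<epsilon>) \<in> {\<epsilon>..1 - \<epsilon>}" by auto
    qed
    show "continuous_on {\<epsilon>..1 - \<epsilon>} f" by fact
  qed (use e in \<open>auto intro!: derivative_eq_intros\<close>)
  then have "((\<lambda>\<tau>. (1 - 2 * \<epsilon>) *\<^sub>R f (\<epsilon> + \<tau> * (1 - 2 * \<epsilon>))) has_integral
     (integral {\<epsilon>..1 - \<epsilon>} f)) {0..1}" by (simp add: algebra_simps)
  then have "((\<lambda>\<tau>. exp ((of_real p - 1) * seg_log \<epsilon> \<tau>) * exp ((of_real q - 1) * seg_log \<epsilon> (1 - \<tau>)) *
          (1 - 2 * of_real \<epsilon>)) has_integral (integral {\<epsilon>..1 - \<epsilon>} f)) {0..1}"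
  proof (rule has_integral_eq[rotated])
    fix \<tau> :: real assume t: "\<tau> \<in> {0..1}"
    have pos: "\<epsilon> + \<tau> * (1 - 2 * \<epsilon>) > 0" if "0 \<le> \<tau>" for \<tau>
      using e that by (intro add_pos_nonneg mult_nonneg_nonneg) auto
    let ?s = "\<epsilon> + \<tau> * (1 - 2 * \<epsilon>)"
    have e1: "\<epsilon> + (1 - \<tau>) * (1 - 2 * \<epsilon>) = 1 - ?s" by (simp add: algebra_simps)
    have p1: "?s > 0" "1 - ?s > 0" using pos[of \<tau>] pos[of "1 - \<tau>"] t unfolding e1 by auto
    have E: "exp ((of_real r - 1) * of_real (ln u)) = complex_of_real (u powr (r - 1))" if "u > 0" for u r :: real
      using that by (simp add: powr_def exp_of_real[symmetric])
    show "(1 - 2 * \<epsilon>) *\<^sub>R f ?s = exp ((of_real p - 1) * seg_log \<epsilon> \<tau>) * exp ((of_real q - 1) * seg_log \<epsilon> (1 - \<tau>)) *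
          (1 - 2 * of_real \<epsilon>)"
      unfolding seg_log_def e1 E[OF p1(1)] E[OF p1(2)] f_def scaleR_conv_of_real by simp
  qed
  then have "seg_beta \<epsilon> (of_real p) (of_real q) = integral {\<epsilon>..1 - \<epsilon>} f"
    unfolding seg_beta_def beta_integral_def by (rule integral_unique)
  with int show ?thesis by (simp add: f_def[abs_def])
qed

text \<open>The denominators of \<open>reg_beta\<close> cancel the monodromy factors of
  \<open>loop_beta_real\<close>. What remains are the integrals over [0, \<epsilon>],
  [\<epsilon>, 1 - \<epsilon>] and [1 - \<epsilon>, 1], which add up to Euler's integral.\<close>

lemma reg_beta_real:
  fixes p q :: real
  assumes e: "0 < \<epsilon>" "\<epsilon> < 1/2" and pq: "0 < p" "0 < q" "p \<notin> \<int>" "q \<notin> \<int>"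
  shows "reg_beta \<epsilon> (of_real p) (of_real q) = Beta (of_real p) (of_real q)"
proof -
  define f where "f t = complex_of_real (t powr (p - 1) * (1 - t) powr (q - 1))" for t
  have e1: "\<epsilon> < 1" using e by simp
  obtain I where I: "(f has_integral I) {0..\<epsilon>}"
    "loop_beta \<epsilon> (of_real p) (of_real q) = (exp (2 * of_real pi * \<i> * of_real p) - 1) * I"
    using loop_beta_real[OF pq(1) e(1) e1, of q] unfolding f_def[abs_def] by blast
  obtain J where J: "((\<lambda>t. of_real (t powr (q - 1) * (1 - t) powr (p - 1))) has_integral J) {0..\<epsilon>}"
    "loop_beta \<epsilon> (of_real q) (of_real p) = (exp (2 * of_real pi * \<i> * of_real q) - 1) * J"
    using loop_beta_real[OF pq(2) e(1) e1, of p] by blast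
  have "((\<lambda>t. f (1 - t)) has_integral J) {0..\<epsilon>}"
    using J(1) by (simp add: f_def mult.commute)
  then have J': "(f has_integral J) {1 - \<epsilon>..1}"
    using has_integral_affinity[of "\<lambda>t. f (1 - t)" J 0 \<epsilon> "-1" 1]
    by (simp add: image_affinity_atLeastAtMost)
  have "(f has_integral (I + seg_beta \<epsilon> (of_real p) (of_real q))) {0..1 - \<epsilon>}"
    by (rule has_integral_combine[OF _ _ I(1)])
       (use has_integral_seg_beta[OF e, of p q] e in \<open>auto simp: f_def[abs_def]\<close>)
  then have "(f has_integral (I + seg_beta \<epsilon> (of_real p) (of_real q) + J)) {0..1}"
    by (rule has_integral_combine[rotated 2]) (use J' e in auto)
  moreover have "(f has_integral of_real (Beta p q)) {0..1}"
    unfolding f_def using has_integral_Beta_real[OF pq(1,2)] by (rule has_integral_of_real)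
  ultimately have "I + seg_beta \<epsilon> (of_real p) (of_real q) + J = of_real (Beta p q)"
    by (rule has_integral_unique)
  moreover have "exp (2 * of_real pi * \<i> * complex_of_real p) - 1 \<noteq> 0" "exp (2 * of_real pi * \<i> * complex_of_real q) - 1 \<noteq> 0"
    using pq exp_two_pi_i_neq_1[of "of_real p"] exp_two_pi_i_neq_1[of "of_real q"]
    by (simp_all add: of_real_in_Ints_iff)
  ultimately show ?thesis
    by (simp add: reg_beta_def I(2) J(2) Beta_complex_of_real)
qed

text \<open>The plane minus the integers is connected, because only a countable set is removed, and
  the interval (0, 1) accumulates at 1/2 inside it. The identity theorem therefore applies.\<close>

lemma eq_on_nonint_if_eq_on_real:
  assumes "f holomorphic_on - \<int>" "g holomorphic_on - \<int>"
    and eq: "\<And>t::real. 0 < t \<Longrightarrow> t < 1 \<Longrightarrow> f (of_real t) = g (of_real t)"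
    and z: "z \<notin> \<int>"
  shows "f z = g z"
proof -
  let ?U = "complex_of_real ` {0<..<1}"
  have nonint: "t \<notin> \<int>" if "0 < t" "t < 1" for t :: real
    using that by (auto simp: Ints_def)
  then have U: "?U \<subseteq> - \<int>" by (auto simp: of_real_in_Ints_iff)
  have "f z - g z = 0"
  proof (rule analytic_continuation[of "\<lambda>z. f z - g z" "- \<int>" ?U "of_real (1/2)"])
    show "open (- \<int> :: complex set)" by (simp add: open_Compl)
    have "countable (\<int> :: complex set)" by (simp add: Ints_def)
    then show "connected (- \<int> :: complex set)"
      using connected_open_diff_countable[of UNIV "\<int> :: complex set"] connected_UNIV by (simp add: Compl_eq_Diff_UNIV)
    show "complex_of_real (1/2) islimpt ?U"
    proof (subst islimpt_approachable, safe)
      fix d :: real assume "0 < d"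
      \<comment> \<open>The displacement is at most 1/4, which keeps the point in (0, 1), and at
        most d / 2, which keeps it within d.\<close>
      then have "complex_of_real (1/2 + min d (1/2) / 2) \<in> ?U" by (intro imageI) (auto simp: min_def)
      moreover have "1/2 + min d (1/2) / 2 \<noteq> 1/2" using \<open>0 < d\<close> by (simp add: min_def)
      moreover have "dist (1/2 + min d (1/2) / 2) (1/2) < d" using \<open>0 < d\<close> by (simp add: dist_real_def min_def)
      ultimately show "\<exists>x'\<in>?U. x' \<noteq> complex_of_real (1/2) \<and> dist x' (complex_of_real (1/2)) < d"
        by (intro bexI[of _ "complex_of_real (1/2 + min d (1/2) / 2)"]) (simp_all only: dist_of_real of_real_eq_iff not_False_eq_True simp_thms)
    qed
  qed (use assms U in \<open>auto intro!: holomorphic_intros\<close>)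
  then show ?thesis by simp
qed

theorem reg_beta_eq_Beta:
  assumes e: "0 < \<epsilon>" "\<epsilon> < 1/2" and pq: "p \<notin> \<int>" "q \<notin> \<int>"
  shows "reg_beta \<epsilon> p q = Beta p q"
proof -
  have nonpos: "z \<in> \<int>" if "z \<in> \<int>\<^sub>\<le>\<^sub>0" for z :: complex
    using that nonpos_Ints_subset_Ints by blast
  have hol: "(\<lambda>p. Beta p q) holomorphic_on - \<int>" "(\<lambda>p. Beta q p) holomorphic_on - \<int>"
    if "q \<notin> \<int>" for q :: complex
    using that by (auto intro!: holomorphic_intros dest: nonpos)
  have nonint: "t \<notin> \<int>" if "0 < t" "t < 1" for t :: real
    using that by (auto simp: Ints_def)
  \<comment> \<open>Continuation one variable at a time: here the second parameter is frozen at a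
    real t in (0, 1) and \<open>p\<close> is freed. The last step frees the second parameter for the
    given non-integral \<open>p\<close>.\<close>
  have 1: "reg_beta \<epsilon> p (of_real t) = Beta p (of_real t)" if t: "0 < t" "t < 1" and p: "p \<notin> \<int>" for t p
  proof (rule eq_on_nonint_if_eq_on_real[OF _ _ _ p])
    show "(\<lambda>p. reg_beta \<epsilon> p (of_real t)) holomorphic_on - \<int>"
      by (rule holomorphic_reg_beta[OF e])
    show "(\<lambda>p. Beta p (complex_of_real t)) holomorphic_on - \<int>"
      using nonint[OF t] by (intro hol) (simp add: of_real_in_Ints_iff)
    show "reg_beta \<epsilon> (of_real s) (of_real t) = Beta (of_real s) (of_real t)" if "0 < s" "s < 1" for s
      using e t that nonint by (intro reg_beta_real) auto
  qed
  show ?thesis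
    by (rule eq_on_nonint_if_eq_on_real[OF holomorphic_reg_beta(2)[OF e] hol(2)[OF pq(1)] _ pq(2)])
       (use 1 pq in auto)
qed

section \<open>Logarithms along the paths\<close>

text \<open>The difference of two logarithms of one path is continuous with values in 2 pi i times
  the integers, a discrete set, hence constant on the connected interval.\<close>

lemma is_log_along_unique:
  assumes "is_log_along \<gamma> L" "is_log_along \<gamma> L'" "L 0 = L' 0" "\<tau> \<in> {0..1}"
  shows "L \<tau> = L' \<tau>"
proof -
  have "(\<lambda>\<tau>. L \<tau> - L' \<tau>) constant_on {0..1}"
  proof (rule continuous_discrete_range_constant)
    show "connected {0..1::real}" by simp
    show "continuous_on {0..1} (\<lambda>\<tau>. L \<tau> - L' \<tau>)"
      using assms(1,2) by (auto simp: is_log_along_def intro!: continuous_intros)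
    have *: "\<exists>n::int. L \<tau> - L' \<tau> = 2 * of_int n * of_real pi * \<i>" if "\<tau> \<in> {0..1}" for \<tau>
    proof -
      have "exp (L \<tau>) = exp (L' \<tau>)" using assms(1,2) that by (simp add: is_log_along_def)
      then obtain n :: int where "L \<tau> = L' \<tau> + (of_int (2 * n) * pi) * \<i>" by (auto simp: exp_eq)
      then show ?thesis by (intro exI[of _ n]) simp
    qed
    show "\<exists>e>0. \<forall>y. y \<in> {0..1} \<and> L y - L' y \<noteq> L x - L' x \<longrightarrow> e \<le> cmod (L y - L' y - (L x - L' x))"
      if x: "x \<in> {0..1}" for x
    \<comment> \<open>Distinct multiples of 2 pi i are at least 2 pi apart, so 1 is a valid
      separation.\<close>
    proof (intro exI[of _ 1] conjI allI impI)
      fix y assume y: "y \<in> {0..1} \<and> L y - L' y \<noteq> L x - L' x"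
      obtain n j :: int where n: "L y - L' y = 2 * of_int n * of_real pi * \<i>" "L x - L' x = 2 * of_int j * of_real pi * \<i>"
        using *[OF x] *[of y] y by blast
      have "n \<noteq> j" using y n by auto
      then have "1 \<le> \<bar>real_of_int (n - j)\<bar>" by linarith
      then have "1 * 1 \<le> \<bar>real_of_int (n - j)\<bar> * (2 * pi)"
        using pi_ge_two by (intro mult_mono) auto
      moreover have "L y - L' y - (L x - L' x) = of_real (real_of_int (n - j) * (2 * pi)) * \<i>"
        unfolding n by (simp add: algebra_simps)
      then have "cmod (L y - L' y - (L x - L' x)) = \<bar>real_of_int (n - j)\<bar> * (2 * pi)"
        by (simp only: norm_mult norm_of_real norm_ii abs_mult) simp
      ultimately show "1 \<le> cmod (L y - L' y - (L x - L' x))" by simp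
    qed simp
  qed
  then obtain k where k: "\<And>\<tau>. \<tau> \<in> {0..1} \<Longrightarrow> L \<tau> - L' \<tau> = k" by (auto simp: constant_on_def)
  have "L \<tau> - L' \<tau> = L 0 - L' 0" using k[OF assms(4)] k[of 0] by simp
  then show ?thesis using assms(3) by simp
qed

text \<open>Uniqueness resolves the choice in \<open>continued_log\<close>: exhibiting any logarithm
  with the right starting value computes it on the unit interval.\<close>

lemma continued_log_eq:
  assumes "is_log_along \<gamma> L" "\<tau> \<in> {0..1}"
  shows "continued_log \<gamma> (L 0) \<tau> = L \<tau>"
proof -
  have "is_log_along \<gamma> (continued_log \<gamma> (L 0)) \<and> continued_log \<gamma> (L 0) 0 = L 0"
    unfolding continued_log_def by (rule someI[of _ L]) (use assms in simp)
  then show ?thesis using is_log_along_unique[of \<gamma> "continued_log \<gamma> (L 0)" L] assms by simp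
qed

lemma Ln_at_eqI:
  assumes "exp w = z" "\<bar>Im w - \<theta>\<bar> < pi"
  shows "Ln_at \<theta> z = w"
proof -
  have "Ln (z * cis (- \<theta>)) = w - \<i> * of_real \<theta>"
  proof (rule Ln_unique)
    show "exp (w - \<i> * of_real \<theta>) = z * cis (- \<theta>)"
      unfolding assms(1)[symmetric] cis_conv_exp exp_add[symmetric] by simp
  qed (use assms(2) in auto)
  then show ?thesis by (simp add: Ln_at_def)
qed

lemma exp_Ln_at:
  assumes "z \<noteq> 0"
  shows "exp (Ln_at \<theta> z) = z"
proof -
  have "exp (Ln_at \<theta> z) = z * (cis (- \<theta>) * exp (\<i> * of_real \<theta>))"
    using assms by (simp add: Ln_at_def exp_add)
  also have "cis (- \<theta>) * exp (\<i> * of_real \<theta>) = 1"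
    by (simp add: cis_conv_exp exp_add[symmetric])
  finally show ?thesis by simp
qed

text \<open>
  Real values of the logarithms at the start put every factor of u on the branch of argument near
  \<open>-\<pi>\<close>; the bounds on the norm keep the binomial expansions convergent.
\<close>

definition lifted_path ::
  "real \<Rightarrow> (real \<Rightarrow> complex) \<Rightarrow> (real \<Rightarrow> complex) \<Rightarrow> (real \<Rightarrow> complex) \<Rightarrow> (real \<Rightarrow> complex) \<Rightarrow> bool" where
  "lifted_path \<epsilon> \<sigma> A B d \<longleftrightarrow>
     continuous_on {0..1} A \<and> continuous_on {0..1} B \<and> continuous_on {0..1} d \<and>
     Im (A 0) = 0 \<and> Im (B 0) = 0 \<and>
     (\<forall>\<tau>\<in>{0..1}. exp (A \<tau>) = \<sigma> \<tau> \<and> exp (B \<tau>) = 1 - \<sigma> \<tau> \<and> \<epsilon> \<le> norm (\<sigma> \<tau>) \<and> norm (\<sigma> \<tau>) \<le> 1 + \<epsilon> \<and>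
        (\<sigma> has_vector_derivative d \<tau>) (at \<tau> within {0..1}))"

lemma exp_loop_log:
  assumes "0 < \<epsilon>"
  shows "exp (loop_log \<epsilon> \<tau>) = of_real \<epsilon> * exp (2 * of_real pi * \<i> * of_real \<tau>)"
  using assms by (simp add: loop_log_def exp_add exp_of_real)

lemma lifted_path_loop:
  assumes "0 < \<epsilon>" "\<epsilon> < 1/2"
  shows "lifted_path \<epsilon> (circlepath 0 \<epsilon>) (loop_log \<epsilon>) (\<lambda>\<tau>. Ln (1 - exp (loop_log \<epsilon> \<tau>)))
    (\<lambda>\<tau>. 2 * of_real pi * \<i> * exp (loop_log \<epsilon> \<tau>))"
proof -
  have c: "circlepath 0 \<epsilon> \<tau> = exp (loop_log \<epsilon> \<tau>)" for \<tau>
    using assms by (simp add: circlepath exp_loop_log)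
  have d: "(circlepath 0 \<epsilon> has_vector_derivative 2 * of_real pi * \<i> * exp (loop_log \<epsilon> \<tau>)) (at \<tau> within S)" for \<tau> S
  proof -
    have "(exp \<circ> loop_log \<epsilon> has_vector_derivative 2 * of_real pi * \<i> * exp (loop_log \<epsilon> \<tau>)) (at \<tau>)"
      by (rule field_vector_diff_chain_at[OF loop_log_deriv DERIV_exp])
    moreover have "exp \<circ> loop_log \<epsilon> = circlepath 0 \<epsilon>" by (auto simp: c)
    ultimately show ?thesis by (simp add: has_vector_derivative_at_within)
  qed
  have nz: "1 - exp (loop_log \<epsilon> \<tau>) \<noteq> 0" for \<tau>
  proof -
    have "norm (exp (loop_log \<epsilon> \<tau>)) < 1"
      unfolding norm_exp_loop_log[OF assms(1)] using assms by simp
    then show ?thesis by (rule one_minus_nonzero)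
  qed
  have r: "1 - exp (loop_log \<epsilon> 0) = of_real (1 - \<epsilon>)" using assms by (simp add: exp_loop_log)
  have im: "Im (Ln (1 - exp (loop_log \<epsilon> 0))) = 0"
    unfolding r using assms by (subst Ln_of_real) auto
  show ?thesis
    unfolding lifted_path_def
  proof (intro conjI ballI)
    show "continuous_on {0..1} (\<lambda>\<tau>. Ln (1 - exp (loop_log \<epsilon> \<tau>)))"
      "continuous_on {0..1} (\<lambda>\<tau>. 2 * of_real pi * \<i> * exp (loop_log \<epsilon> \<tau>))"
      using continuous_loop_data[of \<epsilon>] assms by simp_all
    fix \<tau>
    show "exp (Ln (1 - exp (loop_log \<epsilon> \<tau>))) = 1 - circlepath 0 \<epsilon> \<tau>"
      unfolding c using nz by (rule exp_Ln)
    show "\<epsilon> \<le> cmod (circlepath 0 \<epsilon> \<tau>)" "cmod (circlepath 0 \<epsilon> \<tau>) \<le> 1 + \<epsilon>"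
      unfolding c using assms norm_exp_loop_log[of \<epsilon> \<tau>] by auto
  qed (use im in \<open>simp_all add: continuous_loop_log c d\<close>, simp add: loop_log_def)
qed

lemma lifted_path_seg:
  assumes "0 < \<epsilon>" "\<epsilon> < 1/2"
  shows "lifted_path \<epsilon> (linepath (of_real \<epsilon>) (of_real (1 - \<epsilon>))) (seg_log \<epsilon>) (\<lambda>\<tau>. seg_log \<epsilon> (1 - \<tau>))
    (\<lambda>\<tau>. 1 - 2 * of_real \<epsilon>)"
proof -
  have pos: "\<epsilon> + \<tau> * (1 - 2 * \<epsilon>) \<ge> \<epsilon>" if "0 \<le> \<tau>" for \<tau>
    using assms that by simp
  have e1: "\<epsilon> + (1 - \<tau>) * (1 - 2 * \<epsilon>) = 1 - (\<epsilon> + \<tau> * (1 - 2 * \<epsilon>))" for \<tau>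
    by (simp add: algebra_simps)
  have l: "linepath (of_real \<epsilon>) (of_real (1 - \<epsilon>)) \<tau> = complex_of_real (\<epsilon> + \<tau> * (1 - 2 * \<epsilon>))" for \<tau>
    by (simp add: linepath_def scaleR_conv_of_real algebra_simps)
  have E: "exp (seg_log \<epsilon> \<tau>) = of_real (\<epsilon> + \<tau> * (1 - 2 * \<epsilon>))" if "0 \<le> \<tau>" for \<tau>
    unfolding seg_log_def exp_of_real using pos[OF that] assms by (subst exp_ln) auto
  show ?thesis
    unfolding lifted_path_def
  proof (intro conjI ballI)
    fix \<tau> :: real assume t: "\<tau> \<in> {0..1}"
    have t1: "\<epsilon> \<le> \<epsilon> + \<tau> * (1 - 2 * \<epsilon>)" "\<epsilon> + \<tau> * (1 - 2 * \<epsilon>) \<le> 1 - \<epsilon>"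
      using pos[of \<tau>] pos[of "1 - \<tau>"] t unfolding e1 by auto
    show "exp (seg_log \<epsilon> \<tau>) = linepath (of_real \<epsilon>) (of_real (1 - \<epsilon>)) \<tau>"
      unfolding l using t by (intro E) simp
    have "exp (seg_log \<epsilon> (1 - \<tau>)) = of_real (\<epsilon> + (1 - \<tau>) * (1 - 2 * \<epsilon>))"
      using t by (intro E) simp
    also have "\<dots> = 1 - linepath (of_real \<epsilon>) (of_real (1 - \<epsilon>)) \<tau>"
      unfolding e1 l by simp
    finally show "exp (seg_log \<epsilon> (1 - \<tau>)) = 1 - linepath (of_real \<epsilon>) (of_real (1 - \<epsilon>)) \<tau>" .
    show "\<epsilon> \<le> cmod (linepath (of_real \<epsilon>) (of_real (1 - \<epsilon>)) \<tau>)"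
      "cmod (linepath (of_real \<epsilon>) (of_real (1 - \<epsilon>)) \<tau>) \<le> 1 + \<epsilon>"
      unfolding l norm_of_real using t1 assms by linarith+
    show "(linepath (of_real \<epsilon>) (of_real (1 - \<epsilon>)) has_vector_derivative 1 - 2 * complex_of_real \<epsilon>) (at \<tau> within {0..1})"
      using has_vector_derivative_linepath_within[of "complex_of_real \<epsilon>" "of_real (1 - \<epsilon>)" \<tau> "{0..1}"]
      by (simp add: algebra_simps)
  qed (use continuous_seg_log[OF assms] in \<open>auto simp: seg_log_def\<close>)
qed

text \<open>Starting at angle pi makes the loop around 1 the image of the loop around 0 under s -> 1
  - s with the same parameter, so the logarithms of s and 1 - s just trade places.\<close>

lemma part_circlepath_eq_one_minus:
  "part_circlepath 1 \<epsilon> pi (3 * pi) = (\<lambda>\<tau>. 1 - circlepath 0 \<epsilon> \<tau>)"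
proof
  fix \<tau>
  have "exp (\<i> * linepath pi (3 * pi) \<tau>) = exp (of_real pi * \<i>) * exp (2 * of_real pi * \<i> * of_real \<tau>)"
    unfolding exp_add[symmetric] by (simp add: linepath_def algebra_simps)
  then show "part_circlepath 1 \<epsilon> pi (3 * pi) \<tau> = 1 - circlepath 0 \<epsilon> \<tau>"
    by (simp add: part_circlepath_def circlepath)
qed

text \<open>This path accounts for the outer radius in \<open>lifted_path\<close>, since it passes
  through 1 + \<epsilon>. The inner bound holds because 1 - \<epsilon> > \<epsilon>.\<close>

lemma lifted_path_loop_one:
  assumes "0 < \<epsilon>" "\<epsilon> < 1/2"
  shows "lifted_path \<epsilon> (part_circlepath 1 \<epsilon> pi (3 * pi)) (\<lambda>\<tau>. Ln (1 - exp (loop_log \<epsilon> \<tau>))) (loop_log \<epsilon>)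
    (\<lambda>\<tau>. - (2 * of_real pi * \<i> * exp (loop_log \<epsilon> \<tau>)))"
proof -
  note L = lifted_path_loop[OF assms, unfolded lifted_path_def]
  have n: "\<epsilon> \<le> cmod (1 - circlepath 0 \<epsilon> \<tau>) \<and> cmod (1 - circlepath 0 \<epsilon> \<tau>) \<le> 1 + \<epsilon>" for \<tau>
  proof -
    have "cmod (circlepath 0 \<epsilon> \<tau>) = \<epsilon>" using assms by (simp add: circlepath norm_mult)
    then show ?thesis
      using norm_triangle_ineq4[of 1 "circlepath 0 \<epsilon> \<tau>"] norm_triangle_ineq2[of 1 "circlepath 0 \<epsilon> \<tau>"] assms
      by simp
  qed
  show ?thesis
    unfolding lifted_path_def part_circlepath_eq_one_minus
  proof (intro conjI ballI)
    fix \<tau> :: real assume t: "\<tau> \<in> {0..1}"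
    have "((\<lambda>\<tau>. 1 - circlepath 0 \<epsilon> \<tau>) has_vector_derivative
       0 - 2 * of_real pi * \<i> * exp (loop_log \<epsilon> \<tau>)) (at \<tau> within {0..1})"
      using L t by (intro has_vector_derivative_diff has_vector_derivative_const) blast
    then show "((\<lambda>\<tau>. 1 - circlepath 0 \<epsilon> \<tau>) has_vector_derivative
       - (2 * of_real pi * \<i> * exp (loop_log \<epsilon> \<tau>))) (at \<tau> within {0..1})" by simp
    show "exp (Ln (1 - exp (loop_log \<epsilon> \<tau>))) = 1 - circlepath 0 \<epsilon> \<tau>"
      using L t by blast
  qed (use L n in \<open>auto intro: continuous_on_minus\<close>)
qed

section \<open>Termwise integration of products of binomial series\<close>

text \<open>A finite set of index functions lies in the box of its coordinate projections. The sum
  over a finite box factors, and each factor is at most the full one-variable sum; this bounds all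
  finite partial sums.\<close>

lemma summable_on_PiE_prod:
  fixes f :: "'a \<Rightarrow> 'b \<Rightarrow> real"
  assumes fin: "finite A" and nonneg: "\<And>x y. x \<in> A \<Longrightarrow> 0 \<le> f x y" and sm: "\<And>x. x \<in> A \<Longrightarrow> f x summable_on UNIV"
  shows "(\<lambda>g. \<Prod>x\<in>A. f x (g x)) summable_on (PiE A (\<lambda>_. UNIV))"
proof (rule nonneg_bdd_above_summable_on)
  show "0 \<le> (\<Prod>x\<in>A. f x (g x))" for g using nonneg by (intro prod_nonneg) auto
  show "bdd_above (sum (\<lambda>g. \<Prod>x\<in>A. f x (g x)) ` {F. F \<subseteq> PiE A (\<lambda>_. UNIV :: 'b set) \<and> finite F})"
  proof (rule bdd_aboveI2)
    fix F assume F: "F \<in> {F. F \<subseteq> PiE A (\<lambda>_. UNIV :: 'b set) \<and> finite F}"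
    define G where "G x = (\<lambda>g. g x) ` F" for x
    have "F \<subseteq> PiE A G" using F by (auto simp: G_def PiE_iff)
    moreover have finG: "finite (G x)" for x using F by (simp add: G_def)
    ultimately have "(\<Sum>g\<in>F. \<Prod>x\<in>A. f x (g x)) \<le> (\<Sum>g\<in>PiE A G. \<Prod>x\<in>A. f x (g x))"
      using nonneg fin by (intro sum_mono2 finite_PiE prod_nonneg) auto
    also have "\<dots> = (\<Prod>x\<in>A. \<Sum>y\<in>G x. f x y)"
      using fin finG by (subst prod_sum_PiE) auto
    also have "\<dots> \<le> (\<Prod>x\<in>A. infsum (f x) UNIV)"
      using finG nonneg sm by (intro prod_mono conjI sum_nonneg finite_sum_le_infsum) auto
    finally show "(\<Sum>g\<in>F. \<Prod>x\<in>A. f x (g x)) \<le> (\<Prod>x\<in>A. infsum (f x) UNIV)" .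
  qed
qed

lemma binomial_series_norm_summable:
  fixes e w :: complex
  assumes "norm w < 1"
  shows "summable (\<lambda>n. norm ((e gchoose n) * (- w) ^ n))"
proof -
  have "norm (complex_of_real ((norm w + 1) / 2)) = (norm w + 1) / 2" unfolding norm_of_real by simp
  then show ?thesis
    using assms by (intro powser_insidea[OF sums_summable[OF gen_binomial_complex[of "of_real ((norm w + 1) / 2)"]]]) auto
qed

lemma binomial_series_has_sum:
  fixes e w :: complex
  assumes "norm w < 1"
  shows "((\<lambda>n. (e gchoose n) * (- w) ^ n) has_sum (1 - w) powr e) UNIV"
  using norm_summable_imp_has_sum[OF binomial_series_norm_summable[OF assms]]
    gen_binomial_complex[of "- w" e] assms by simp

text \<open>Weierstrass M-test over finite sets of multi-indices: replacing every
  \<open>w l \<tau>\<close> by its radius \<open>\<rho> l\<close> and bounding \<open>g\<close> by a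
  constant gives a summable majorant independent of \<tau>. The partial sums then converge uniformly
  and the integral passes to the limit.\<close>

lemma has_sum_integral_binomial_series:
  fixes g :: "real \<Rightarrow> complex" and w :: "'a \<Rightarrow> real \<Rightarrow> complex"
  assumes fin: "finite I" and g: "continuous_on {0..1} g"
    and w: "\<And>l. l \<in> I \<Longrightarrow> continuous_on {0..1} (w l)"
    and le: "\<And>l \<tau>. l \<in> I \<Longrightarrow> \<tau> \<in> {0..1} \<Longrightarrow> norm (w l \<tau>) \<le> \<rho> l" and less: "\<And>l. l \<in> I \<Longrightarrow> \<rho> l < 1"
  shows "((\<lambda>n. integral {0..1} (\<lambda>\<tau>. g \<tau> * (\<Prod>l\<in>I. (e l gchoose n l) * (- w l \<tau>) ^ n l))) has_sum
           integral {0..1} (\<lambda>\<tau>. g \<tau> * (\<Prod>l\<in>I. (1 - w l \<tau>) powr e l))) (PiE I (\<lambda>_. UNIV))"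
proof -
  let ?P = "PiE I (\<lambda>_. UNIV :: nat set)"
  define F where "F n \<tau> = g \<tau> * (\<Prod>l\<in>I. (e l gchoose n l) * (- w l \<tau>) ^ n l)" for n \<tau>
  define S where "S \<tau> = g \<tau> * (\<Prod>l\<in>I. (1 - w l \<tau>) powr e l)" for \<tau>
  have \<rho>0: "0 \<le> \<rho> l" if "l \<in> I" for l
    using order_trans[OF norm_ge_zero le[OF that, of 0]] by simp
  have "compact (g ` {0..1})" using g by (intro compact_continuous_image) auto
  then have "bounded (g ` {0..1})" by (rule compact_imp_bounded)
  then obtain M0 where "\<forall>z\<in>g ` {0..1}. norm z \<le> M0"
    unfolding bounded_iff by blast
  then have M0: "norm (g \<tau>) \<le> M0" if "\<tau> \<in> {0..1}" for \<tau>
    using that by blast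
  have sm: "(\<lambda>n. \<Prod>l\<in>I. norm ((e l gchoose n l) * (- of_real (\<rho> l)) ^ n l)) summable_on ?P"
  proof (rule summable_on_PiE_prod[OF fin, of "\<lambda>l j. norm ((e l gchoose j) * (- of_real (\<rho> l)) ^ j)"])
    fix l assume "l \<in> I"
    then have "summable (\<lambda>j. norm ((e l gchoose j) * (- complex_of_real (\<rho> l)) ^ j))"
      using less \<rho>0 by (intro binomial_series_norm_summable) simp
    then show "(\<lambda>j. norm ((e l gchoose j) * (- complex_of_real (\<rho> l)) ^ j)) summable_on UNIV"
      by (intro norm_summable_imp_summable_on) simp
  qed simp
  have le_prod: "norm (\<Prod>l\<in>I. (e l gchoose n l) * (- w l \<tau>) ^ n l) \<le>
      (\<Prod>l\<in>I. norm ((e l gchoose n l) * (- of_real (\<rho> l)) ^ n l))" if "\<tau> \<in> {0..1}" for n \<tau>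
    unfolding prod_norm[symmetric]
    using le[OF _ that] \<rho>0 by (intro prod_mono) (auto simp: norm_mult norm_power intro!: mult_left_mono power_mono)
  have S: "((\<lambda>n. F n \<tau>) has_sum S \<tau>) ?P" if \<tau>: "\<tau> \<in> {0..1}" for \<tau>
  proof -
    have hs: "((\<lambda>j. (e l gchoose j) * (- w l \<tau>) ^ j) has_sum (1 - w l \<tau>) powr e l) UNIV" if "l \<in> I" for l
      using le[OF that \<tau>] less[OF that] by (intro binomial_series_has_sum) simp
    have "(\<lambda>n. norm (\<Prod>l\<in>I. (e l gchoose n l) * (- w l \<tau>) ^ n l)) summable_on ?P"
      by (rule summable_on_comparison_test[OF sm]) (use le_prod[OF \<tau>] in auto)
    then have sP: "(\<lambda>n. \<Prod>l\<in>I. (e l gchoose n l) * (- w l \<tau>) ^ n l) summable_on ?P"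
      by (rule abs_summable_summable)
    have "(\<Sum>\<^sub>\<infinity>n\<in>?P. \<Prod>l\<in>I. (e l gchoose n l) * (- w l \<tau>) ^ n l) = (\<Prod>l\<in>I. (1 - w l \<tau>) powr e l)"
      using hs by (subst infsum_prod_PiE[OF fin _ sP]) (auto simp: has_sum_iff intro!: prod.cong)
    then have "((\<lambda>n. \<Prod>l\<in>I. (e l gchoose n l) * (- w l \<tau>) ^ n l) has_sum (\<Prod>l\<in>I. (1 - w l \<tau>) powr e l)) ?P"
      using sP by (simp add: has_sum_iff)
    then show ?thesis unfolding F_def S_def by (rule has_sum_cmult_right)
  qed
  have lim: "uniform_limit {0..1} (\<lambda>X \<tau>. \<Sum>n\<in>X. F n \<tau>) S (finite_subsets_at_top ?P)"
  proof (rule Weierstrass_m_test_general'[OF _ S])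
    show "(\<lambda>n. M0 * (\<Prod>l\<in>I. norm ((e l gchoose n l) * (- of_real (\<rho> l)) ^ n l))) summable_on ?P"
      by (rule summable_on_cmult_right[OF sm])
    show "norm (F n \<tau>) \<le> M0 * (\<Prod>l\<in>I. norm ((e l gchoose n l) * (- of_real (\<rho> l)) ^ n l))"
      if "\<tau> \<in> {0..1}" for n \<tau>
      unfolding F_def norm_mult[of "g \<tau>"]
      using M0[OF that] le_prod[OF that] order_trans[OF norm_ge_zero M0[OF that]] by (intro mult_mono) auto
  qed
  have contF: "continuous_on {0..1} (F n)" for n
    unfolding F_def using w g by (intro continuous_intros) auto
  have "continuous_on {0..1} (\<lambda>\<tau>. \<Sum>n\<in>X. F n \<tau>)" for X
    using contF by (intro continuous_on_sum)
  \<comment> \<open>The limit is taken along the filter of finite subsets, so \<open>II X\<close> is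
    the integral of a partial sum and \<open>J\<close> that of the full product.\<close>
  from uniform_limit_integral[OF lim this finite_subsets_at_top_neq_bot]
  obtain II J where IJ: "\<And>X. ((\<lambda>\<tau>. \<Sum>n\<in>X. F n \<tau>) has_integral II X) {0..1}"
      "(S has_integral J) {0..1}" "(II \<longlongrightarrow> J) (finite_subsets_at_top ?P)"
    by blast
  have "II X = (\<Sum>n\<in>X. integral {0..1} (F n))" if "finite X" for X
  proof -
    have "II X = integral {0..1} (\<lambda>\<tau>. \<Sum>n\<in>X. F n \<tau>)" using IJ(1)[of X] by (simp add: integral_unique)
    also have "\<dots> = (\<Sum>n\<in>X. integral {0..1} (F n))"
      using that contF by (intro integral_sum integrable_continuous_real) auto
    finally show ?thesis .
  qed
  then have "\<forall>\<^sub>F X in finite_subsets_at_top ?P. II X = (\<Sum>n\<in>X. integral {0..1} (F n))"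
    by (intro eventually_finite_subsets_at_top_weakI) auto
  then have "((\<lambda>X. \<Sum>n\<in>X. integral {0..1} (F n)) \<longlongrightarrow> J) (finite_subsets_at_top ?P)"
    using IJ(3) by (simp add: tendsto_cong)
  then show ?thesis
    using integral_unique[OF IJ(2)] by (simp add: has_sum_def F_def[abs_def] S_def[abs_def])
qed

section \<open>The integrand in the s-plane\<close>

lemma sum_prod_split_at:
  fixes f :: "nat \<Rightarrow> 'a::comm_semiring_1"
  assumes "1 \<le> k" "k \<le> m"
  shows sum_split_at: "sum f {1..m} = sum f {1..k-1} + f k + sum f {k+1..m}"
    and prod_split_at: "prod f {1..m} = prod f {1..k-1} * f k * prod f {k+1..m}"
proof -
  have "{1..m} = insert k ({1..k-1} \<union> {k+1..m})" using assms by auto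
  moreover have "k \<notin> {1..k-1} \<union> {k+1..m}" "{1..k-1} \<inter> {k+1..m} = {}" using assms by auto
  ultimately show "sum f {1..m} = sum f {1..k-1} + f k + sum f {k+1..m}"
    "prod f {1..m} = prod f {1..k-1} * f k * prod f {k+1..m}"
    by (simp_all add: sum.union_disjoint prod.union_disjoint add_ac mult_ac)
qed

text \<open>Open conditions that hold at the base point. The norm bounds make every expansion
  converge on the annulus. The signs of the real parts keep arg x_k within pi/2 of -pi and arg x_l
  within pi/2 of 0 for l < k, which leaves room for one further angle below pi/2.\<close>

definition good_point :: "nat \<Rightarrow> nat \<Rightarrow> real \<Rightarrow> (nat \<Rightarrow> complex) \<Rightarrow> bool" where
  "good_point m k \<epsilon> x \<longleftrightarrow>
     Re (x k) < 0 \<and> norm (x k) < \<epsilon> \<and>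
     (\<forall>l\<in>{1..m}. l < k \<longrightarrow> 0 < Re (x l) \<and> norm (x k / x l) < \<epsilon>) \<and>
     (\<forall>l\<in>{1..m}. k < l \<longrightarrow> norm (x l / x k) * (1 + \<epsilon>) < 1)"

locale near_base =
  fixes m k :: nat and a c :: complex and b x :: "nat \<Rightarrow> complex" and \<epsilon> :: real
  assumes k: "1 \<le> k" "k \<le> m" and eps: "0 < \<epsilon>" "\<epsilon> < 1 / 2" and good: "good_point m k \<epsilon> x"
begin

definition ratio :: "nat \<Rightarrow> complex" where
  "ratio l = (if l < k then x k / x l else if l = k then x k else x l / x k)"

text \<open>With t = x_k / s, one has t - x_l = -x_l (1 - w) for l < k and t - x_l = t (1 - w) for l
  > k, where w = \<open>factor l s\<close>. Since t - x_k = t (1 - s) needs no expansion, slot k is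
  reassigned to the point 1: t - 1 = -(1 - w) with w = x_k / s.\<close>

definition factor :: "nat \<Rightarrow> complex \<Rightarrow> complex" where
  "factor l s = (if l \<le> k then ratio l / s else ratio l * s)"

definition factor_bound :: "nat \<Rightarrow> real" where
  "factor_bound l = (if l \<le> k then norm (ratio l) / \<epsilon> else norm (ratio l) * (1 + \<epsilon>))"

text \<open>Slot k carries the exponent c - a of t - 1, lowered by one by the pole of
  \<open>phi0\<close>.\<close>

definition factor_expo :: "nat \<Rightarrow> complex" where
  "factor_expo l = (if l = k then c - a - 1 else - b l)"

definition log_xk :: complex where "log_xk = Ln_at (- pi) (x k)"

definition lower_sum :: complex where "lower_sum = (\<Sum>l=1..k-1. b l)"

text \<open>Logarithms of t - x_i matching the factorisations above. Where -x_i or -1 is pulled out,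
  the sign is written as exp (-pi i), so that every argument starts near -pi.\<close>

definition factor_log ::
  "(real \<Rightarrow> complex) \<Rightarrow> (real \<Rightarrow> complex) \<Rightarrow> (real \<Rightarrow> complex) \<Rightarrow> nat \<Rightarrow> real \<Rightarrow> complex" where
  "factor_log \<sigma> A B i \<tau> =
     (if i = 0 then log_xk - A \<tau>
      else if i < k then Ln (x i) - of_real pi * \<i> + Ln (1 - factor i (\<sigma> \<tau>))
      else if i = k then log_xk - A \<tau> + B \<tau>
      else if i \<le> m then log_xk - A \<tau> + Ln (1 - factor i (\<sigma> \<tau>))
      else - (of_real pi * \<i>) + Ln (1 - factor k (\<sigma> \<tau>)))"

lemma xk_nonzero: "x k \<noteq> 0" using good by (auto simp: good_point_def)

lemma x_lower: "l \<in> {1..<k} \<Longrightarrow> 0 < Re (x l)" "l \<in> {1..<k} \<Longrightarrow> x l \<noteq> 0"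
proof -
  show "0 < Re (x l)" if "l \<in> {1..<k}" using good k that by (auto simp: good_point_def)
  then show "x l \<noteq> 0" if "l \<in> {1..<k}" using that by auto
qed

lemma exp_log_xk: "exp log_xk = x k"
  unfolding log_xk_def using xk_nonzero by (rule exp_Ln_at)

lemma Im_log_xk: "\<bar>Im log_xk + pi\<bar> < pi / 2"
proof -
  have "0 < Re (- x k)" using good by (simp add: good_point_def)
  then have "\<bar>Im (Ln (- x k))\<bar> < pi / 2" using Re_Ln_pos_lt[of "- x k"] xk_nonzero by simp
  moreover have "x k * cis (- (- pi)) = - x k" by (simp add: complex_eq_iff)
  ultimately show ?thesis by (simp add: log_xk_def Ln_at_def)
qed

lemma factor_bound_less_1:
  assumes "l \<in> {1..m}"
  shows "factor_bound l < 1"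
  using assms good eps by (auto simp: factor_bound_def ratio_def good_point_def)

lemma norm_factor_le:
  assumes "\<epsilon> \<le> norm s" "norm s \<le> 1 + \<epsilon>"
  shows "norm (factor l s) \<le> factor_bound l"
  using assms eps
  by (auto simp: factor_def factor_bound_def norm_divide norm_mult intro!: divide_left_mono mult_left_mono mult_pos_pos)

lemma norm_factor_less_1:
  assumes "l \<in> {1..m}" "\<epsilon> \<le> norm s" "norm s \<le> 1 + \<epsilon>"
  shows "norm (factor l s) < 1"
  using norm_factor_le[OF assms(2,3)] factor_bound_less_1[OF assms(1)] by (rule le_less_trans)

lemma lifted_pathD:
  assumes "lifted_path \<epsilon> \<sigma> A B d"
  shows "continuous_on {0..1} A" "continuous_on {0..1} B" "continuous_on {0..1} d"
    "Im (A 0) = 0" "Im (B 0) = 0"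
    "\<And>\<tau>. \<tau> \<in> {0..1} \<Longrightarrow> exp (A \<tau>) = \<sigma> \<tau>" "\<And>\<tau>. \<tau> \<in> {0..1} \<Longrightarrow> exp (B \<tau>) = 1 - \<sigma> \<tau>"
    "\<And>\<tau>. \<tau> \<in> {0..1} \<Longrightarrow> \<epsilon> \<le> norm (\<sigma> \<tau>)" "\<And>\<tau>. \<tau> \<in> {0..1} \<Longrightarrow> norm (\<sigma> \<tau>) \<le> 1 + \<epsilon>"
    "\<And>\<tau>. \<tau> \<in> {0..1} \<Longrightarrow> \<sigma> \<tau> \<noteq> 0"
    "\<And>\<tau>. \<tau> \<in> {0..1} \<Longrightarrow> (\<sigma> has_vector_derivative d \<tau>) (at \<tau> within {0..1})"
    "continuous_on {0..1} \<sigma>"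
proof -
  show n: "\<sigma> \<tau> \<noteq> 0" if "\<tau> \<in> {0..1}" for \<tau>
    using assms eps that by (force simp: lifted_path_def)
  have "continuous_on {0..1} (\<lambda>\<tau>. exp (A \<tau>))"
    using assms by (intro continuous_intros) (simp add: lifted_path_def)
  then show "continuous_on {0..1} \<sigma>"
    by (rule continuous_on_eq) (use assms in \<open>simp add: lifted_path_def\<close>)
qed (use assms in \<open>simp_all add: lifted_path_def\<close>)

lemma continuous_factor:
  assumes "lifted_path \<epsilon> \<sigma> A B d"
  shows "continuous_on {0..1} (\<lambda>\<tau>. factor l (\<sigma> \<tau>))"
  using lifted_pathD[OF assms] unfolding factor_def by (cases "l \<le> k") (auto intro!: continuous_intros)

text \<open>For the starting value it suffices that the imaginary part lies within pi of -pi. The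
  deviation is a sum of at most two angles below pi/2, one from x_i or x_k and one from 1 - w, since
  the logarithms of s and 1 - s are real at the start.\<close>

lemma is_log_along_factor_log:
  assumes P: "lifted_path \<epsilon> \<sigma> A B d" and i: "i \<le> m + 1"
  shows "is_log_along (\<lambda>\<tau>. x k / \<sigma> \<tau> - marked_pt m x i) (factor_log \<sigma> A B i)"
    "factor_log \<sigma> A B i 0 = Ln_at (- pi) (x k / \<sigma> 0 - marked_pt m x i)"
proof -
  note D = lifted_pathD[OF P]
  have Q: "norm (factor l (\<sigma> \<tau>)) < 1" if "l \<in> {1..m}" "\<tau> \<in> {0..1}" for l \<tau>
    using norm_factor_less_1 D(8,9) that by blast
  have cont: "continuous_on {0..1} (\<lambda>\<tau>. Ln (1 - factor l (\<sigma> \<tau>)))" if "l \<in> {1..m}" for l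
    using Q[OF that] continuous_factor[OF P] by (intro continuous_Ln_one_minus) auto
  have expLn: "exp (Ln (1 - factor l (\<sigma> \<tau>))) = 1 - factor l (\<sigma> \<tau>)" if "l \<in> {1..m}" "\<tau> \<in> {0..1}" for l \<tau>
    by (rule exp_Ln[OF one_minus_nonzero[OF Q[OF that]]])
  consider "i = 0" | "i \<in> {1..<k}" | "i = k" | "i \<in> {k<..m}" | "i = m + 1"
    using i by fastforce
  note cases = this
  show log: "is_log_along (\<lambda>\<tau>. x k / \<sigma> \<tau> - marked_pt m x i) (factor_log \<sigma> A B i)"
    unfolding is_log_along_def
  proof (intro conjI ballI)
    show "continuous_on {0..1} (factor_log \<sigma> A B i)"
      using k i unfolding factor_log_def
      by (cases rule: cases) (auto intro!: continuous_intros D(1,2) cont)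
    fix \<tau> :: real assume t: "\<tau> \<in> {0..1}"
    show "exp (factor_log \<sigma> A B i \<tau>) = x k / \<sigma> \<tau> - marked_pt m x i"
    proof (cases rule: cases)
      case 1
      then show ?thesis using D(6)[OF t] by (simp add: factor_log_def marked_pt_def exp_diff exp_log_xk)
    next
      case 2
      then have "exp (factor_log \<sigma> A B i \<tau>) = - x i * (1 - factor i (\<sigma> \<tau>))"
        using expLn[of i \<tau>] t k x_lower[of i] by (simp add: factor_log_def exp_diff exp_add mult.commute[of _ \<i>])
      then show ?thesis using 2 k x_lower[of i] D(10)[OF t]
        by (simp add: factor_def ratio_def marked_pt_def field_simps)
    next
      case 3
      then have "exp (factor_log \<sigma> A B i \<tau>) = x k / \<sigma> \<tau> * (1 - \<sigma> \<tau>)"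
        using k D(6,7)[OF t] by (simp add: factor_log_def exp_diff exp_add exp_log_xk)
      then show ?thesis using 3 k D(10)[OF t]
        by (simp add: marked_pt_def field_simps)
    next
      case 4
      then have "exp (factor_log \<sigma> A B i \<tau>) = x k / \<sigma> \<tau> * (1 - factor i (\<sigma> \<tau>))"
        using k D(6)[OF t] expLn[of i \<tau>] t by (simp add: factor_log_def exp_diff exp_add exp_log_xk)
      then show ?thesis using 4 k D(10)[OF t] xk_nonzero
        by (simp add: factor_def ratio_def marked_pt_def field_simps)
    next
      case 5
      then have "exp (factor_log \<sigma> A B i \<tau>) = - (1 - factor k (\<sigma> \<tau>))"
        using k expLn[of k \<tau>] t by (simp add: factor_log_def exp_diff exp_add exp_minus mult.commute[of _ \<i>])
      then show ?thesis using 5 k D(10)[OF t]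
        by (simp add: factor_def ratio_def marked_pt_def field_simps)
    qed
  qed
  have imf: "\<bar>Im (Ln (1 - factor l (\<sigma> 0)))\<bar> < pi / 2" if "l \<in> {1..m}" for l
  proof -
    have n: "norm (factor l (\<sigma> 0)) < 1" using Q[OF that] by simp
    then have "0 < Re (1 - factor l (\<sigma> 0))" using complex_Re_le_cmod[of "factor l (\<sigma> 0)"] by simp
    then show ?thesis using Re_Ln_pos_lt[OF one_minus_nonzero[OF n]] by simp
  qed
  have iml: "\<bar>Im (Ln (x l))\<bar> < pi / 2" if "l \<in> {1..<k}" for l
    using Re_Ln_pos_lt[of "x l"] x_lower that by simp
  have add_lt_pi: "\<bar>u + v\<bar> < pi" if "\<bar>u\<bar> < pi / 2" "\<bar>v\<bar> < pi / 2" for u v :: real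
    using that by linarith
  have imk: "\<bar>Im log_xk + pi\<bar> < pi" using Im_log_xk pi_gt_zero by linarith
  have "\<bar>Im (factor_log \<sigma> A B i 0) - (- pi)\<bar> < pi"
  proof (cases rule: cases)
    case 1
    then show ?thesis using imk D(4) by (simp add: factor_log_def)
  next
    case 2
    then show ?thesis using add_lt_pi[OF iml[of i] imf[of i]] k by (simp add: factor_log_def)
  next
    case 3
    then show ?thesis using imk D(4,5) k by (simp add: factor_log_def)
  next
    case 4
    then have "Im (factor_log \<sigma> A B i 0) - (- pi) = (Im log_xk + pi) + Im (Ln (1 - factor i (\<sigma> 0)))"
      using D(4) k by (simp add: factor_log_def)
    then show ?thesis using add_lt_pi[OF Im_log_xk imf[of i]] 4 k by simp
  next
    case 5
    then show ?thesis using add_lt_pi[of 0, OF _ imf[of k]] k by (simp add: factor_log_def)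
  qed
  moreover have "exp (factor_log \<sigma> A B i 0) = x k / \<sigma> 0 - marked_pt m x i"
    using log by (simp add: is_log_along_def)
  ultimately show "factor_log \<sigma> A B i 0 = Ln_at (- pi) (x k / \<sigma> 0 - marked_pt m x i)"
    by (intro Ln_at_eqI[symmetric])
qed

lemma u_along_eq:
  assumes P: "lifted_path \<epsilon> \<sigma> A B d" and t: "\<tau> \<in> {0..1}"
  shows "u_along (- pi) m a b c x (\<lambda>\<tau>. x k / \<sigma> \<tau>) \<tau> = (\<Prod>i=0..m+1. exp (expo m a b c i * factor_log \<sigma> A B i \<tau>))"
  unfolding u_along_def
proof (intro prod.cong refl)
  fix i assume "i \<in> {0..m+1}"
  then have i: "i \<le> m + 1" by simp
  note L = is_log_along_factor_log[OF P i]
  show "exp (expo m a b c i * continued_log (\<lambda>\<sigma>'. x k / \<sigma> \<sigma>' - marked_pt m x i) (Ln_at (- pi) (x k / \<sigma> 0 - marked_pt m x i)) \<tau>) =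
      exp (expo m a b c i * factor_log \<sigma> A B i \<tau>)"
    using continued_log_eq[OF L(1) t] L(2) by simp
qed

text \<open>All of the integrand that depends neither on s nor on the multi-index. The
  \<open>+ 1\<close> in the last exponent is the factor x_k of dt = -x_k ds / s^2.\<close>

definition prefactor :: complex where
  "prefactor = exp (of_real pi * \<i> * (lower_sum - c + a)) * (\<Prod>l=1..k-1. x l powr (- b l)) *
     powr_at (- pi) (x k) (lower_sum - c + 1)"

text \<open>The factors that contain t are those at 0, at x_k and at x_l with l > k. Their exponents
  add up to \<open>lower_sum - c\<close>, which is the coefficient of \<open>log_xk\<close> and,
  negated, of \<open>A\<close>. One copy of the logarithm in slot k is split off to be cancelled by
  \<open>phi0\<close>.\<close>

lemma sum_expo_factor_log:
  shows "(\<Sum>i=0..m+1. expo m a b c i * factor_log \<sigma> A B i \<tau>) =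
    of_real pi * \<i> * (lower_sum - c + a) + (\<Sum>l=1..k-1. - b l * Ln (x l)) + (lower_sum - c) * log_xk +
    (c - lower_sum) * A \<tau> + (- b k) * B \<tau> + (\<Sum>l=1..m. factor_expo l * Ln (1 - factor l (\<sigma> \<tau>))) +
    Ln (1 - factor k (\<sigma> \<tau>))"
proof -
  define U where "U l = Ln (1 - factor l (\<sigma> \<tau>))" for l
  have "(\<Sum>i=0..m+1. expo m a b c i * factor_log \<sigma> A B i \<tau>) =
     expo m a b c 0 * factor_log \<sigma> A B 0 \<tau> + (\<Sum>i=1..m. expo m a b c i * factor_log \<sigma> A B i \<tau>) +
     expo m a b c (m+1) * factor_log \<sigma> A B (m+1) \<tau>"
    by (simp add: sum.atLeast_Suc_atMost)
  also have "\<dots> = (- c + (\<Sum>l=1..m. b l)) * (log_xk - A \<tau>) +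
     ((\<Sum>i=1..k-1. - b i * (Ln (x i) - of_real pi * \<i> + U i)) + - b k * (log_xk - A \<tau> + B \<tau>) +
      (\<Sum>i=k+1..m. - b i * (log_xk - A \<tau> + U i))) + (c - a) * (- (of_real pi * \<i>) + U k)"
    unfolding sum_split_at[OF k, of "\<lambda>i. expo m a b c i * factor_log \<sigma> A B i \<tau>"] U_def[symmetric]
    using k by (intro arg_cong2[where f = plus] sum.cong) (auto simp: expo_def factor_log_def U_def)
  also have "(\<Sum>i=1..k-1. - b i * (Ln (x i) - of_real pi * \<i> + U i)) =
      (\<Sum>l=1..k-1. - b l * Ln (x l)) + of_real pi * \<i> * lower_sum + (\<Sum>l=1..k-1. - b l * U l)"
    unfolding lower_sum_def sum_distrib_left sum.distrib[symmetric] by (intro sum.cong) (auto simp: algebra_simps)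
  also have "(\<Sum>i=k+1..m. - b i * (log_xk - A \<tau> + U i)) =
     - (\<Sum>i=k+1..m. b i) * (log_xk - A \<tau>) + (\<Sum>i=k+1..m. - b i * U i)"
    unfolding sum_distrib_right sum_negf[symmetric] sum.distrib[symmetric] by (intro sum.cong) (auto simp: algebra_simps)
  finally have 1: "(\<Sum>i=0..m+1. expo m a b c i * factor_log \<sigma> A B i \<tau>) =
     (- c + (lower_sum + b k + (\<Sum>i=k+1..m. b i))) * (log_xk - A \<tau>) +
     ((\<Sum>l=1..k-1. - b l * Ln (x l)) + of_real pi * \<i> * lower_sum + (\<Sum>l=1..k-1. - b l * U l)
       + - b k * (log_xk - A \<tau> + B \<tau>) +
      (- (\<Sum>i=k+1..m. b i) * (log_xk - A \<tau>) + (\<Sum>i=k+1..m. - b i * U i))) + (c - a) * (- (of_real pi * \<i>) + U k)"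
    unfolding sum_split_at[OF k, of b] lower_sum_def .
  have 2: "(\<Sum>l=1..m. factor_expo l * U l) =
      (\<Sum>l=1..k-1. - b l * U l) + (c - a - 1) * U k + (\<Sum>l=k+1..m. - b l * U l)"
    unfolding sum_split_at[OF k, of "\<lambda>l. factor_expo l * U l"] using k
    by (intro arg_cong2[where f = plus] sum.cong) (auto simp: factor_expo_def)
  show ?thesis
    unfolding 1 U_def[symmetric] 2 by (simp add: algebra_simps)
qed

text \<open>The minus signs of dt = -x_k ds / s^2 and of t - 1 = -(1 - x_k / s) cancel. The power
  s^(-2) moves the exponent of s to p - 1 with p = \<open>c - lower_sum - 1\<close>; the exponents
  stay unsimplified to display p - 1 and q - 1.\<close>

lemma integrand_eq:
  assumes P: "lifted_path \<epsilon> \<sigma> A B d" and t: "\<tau> \<in> {0..1}"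
  shows "u_along (- pi) m a b c x (\<lambda>\<tau>. x k / \<sigma> \<tau>) \<tau> * phi0 (x k / \<sigma> \<tau>) *
      vector_derivative (\<lambda>\<tau>. x k / \<sigma> \<tau>) (at \<tau> within {0..1}) =
    prefactor * (exp ((c - lower_sum - 1 - 1) * A \<tau>) * exp ((1 - b k - 1) * B \<tau>) * d \<tau> *
      (\<Prod>l=1..m. (1 - factor l (\<sigma> \<tau>)) powr factor_expo l))"
proof -
  note D = lifted_pathD[OF P]
  have nz: "\<sigma> \<tau> \<noteq> 0" by (rule D(10)[OF t])
  have fn: "1 - factor l (\<sigma> \<tau>) \<noteq> 0" if "l \<in> {1..m}" for l
    using norm_factor_less_1[OF that D(8,9)[OF t]] by (rule one_minus_nonzero)
  let ?f = "1 - factor k (\<sigma> \<tau>)"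
  have fk: "?f \<noteq> 0" using k by (intro fn) simp
  have "((\<lambda>\<tau>. x k / \<sigma> \<tau>) has_vector_derivative - (x k * d \<tau>) / (\<sigma> \<tau>)\<^sup>2) (at \<tau> within {0..1})"
  proof -
    have "((\<lambda>s. x k / s) has_field_derivative - x k / (\<sigma> \<tau>)\<^sup>2) (at (\<sigma> \<tau>) within \<sigma> ` {0..1})"
      using nz by (auto intro!: derivative_eq_intros simp: power2_eq_square)
    from field_vector_diff_chain_within[OF D(11)[OF t] this] show ?thesis by (simp add: o_def mult.commute)
  qed
  then have vd: "vector_derivative (\<lambda>\<tau>. x k / \<sigma> \<tau>) (at \<tau> within {0..1}) = - (x k * d \<tau>) / (\<sigma> \<tau>)\<^sup>2"
    using t by (intro vector_derivative_within_cbox[of 0 1, simplified]) auto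
  have phi: "phi0 (x k / \<sigma> \<tau>) = - 1 / ?f"
    by (simp add: phi0_def factor_def ratio_def minus_divide_left[symmetric] minus_divide_right)
  have "u_along (- pi) m a b c x (\<lambda>\<tau>. x k / \<sigma> \<tau>) \<tau> =
      exp (\<Sum>i=0..m+1. expo m a b c i * factor_log \<sigma> A B i \<tau>)"
    unfolding u_along_eq[OF P t] by (simp only: exp_sum finite_atLeastAtMost)
  also have "\<dots> = exp (of_real pi * \<i> * (lower_sum - c + a)) * (\<Prod>l=1..k-1. exp (- b l * Ln (x l))) *
      exp ((lower_sum - c) * log_xk) * exp ((c - lower_sum) * A \<tau>) * exp (- b k * B \<tau>) *
      (\<Prod>l=1..m. exp (factor_expo l * Ln (1 - factor l (\<sigma> \<tau>)))) * ?f"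
    unfolding sum_expo_factor_log exp_add using fk by (simp only: exp_sum finite_atLeastAtMost exp_Ln simp_thms if_False)
  also have "(\<Prod>l=1..k-1. exp (- b l * Ln (x l))) = (\<Prod>l=1..k-1. x l powr (- b l))"
    using x_lower(2) by (intro prod.cong) (auto simp: powr_def)
  also have "(\<Prod>l=1..m. exp (factor_expo l * Ln (1 - factor l (\<sigma> \<tau>)))) =
      (\<Prod>l=1..m. (1 - factor l (\<sigma> \<tau>)) powr factor_expo l)"
    using fn by (intro prod.cong) (auto simp: powr_def)
  finally have u: "u_along (- pi) m a b c x (\<lambda>\<tau>. x k / \<sigma> \<tau>) \<tau> = exp (of_real pi * \<i> * (lower_sum - c + a)) *
      (\<Prod>l=1..k-1. x l powr (- b l)) *
      exp ((lower_sum - c) * log_xk) * exp ((c - lower_sum) * A \<tau>) * exp (- b k * B \<tau>) *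
      (\<Prod>l=1..m. (1 - factor l (\<sigma> \<tau>)) powr factor_expo l) * ?f" .
  have e1: "exp ((c - lower_sum) * A \<tau>) = exp ((c - lower_sum - 1 - 1) * A \<tau>) * (\<sigma> \<tau>)\<^sup>2"
    unfolding D(6)[OF t, symmetric] power2_eq_square exp_add[symmetric] by (simp add: algebra_simps)
  have e2: "powr_at (- pi) (x k) (lower_sum - c + 1) = exp ((lower_sum - c) * log_xk) * x k"
    unfolding powr_at_def log_xk_def[symmetric] by (simp add: ring_distribs exp_add exp_log_xk)
  show ?thesis
    unfolding u vd phi e1 prefactor_def e2 using fk nz by simp
qed

text \<open>Written through a logarithm of s, so that the integer power can be merged with the
  non-integral one.\<close>

lemma factor_power:
  assumes "exp w = s"
  shows "(factor l s) ^ j = ratio l ^ j * exp ((if l \<le> k then - of_nat j else of_nat j) * w)"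
proof -
  have "exp (of_nat j * w) = s ^ j" using assms by (simp add: exp_of_nat_mult)
  then show ?thesis
    by (auto simp: factor_def power_divide power_mult_distrib exp_minus divide_inverse power_inverse)
qed

text \<open>The net power of 1/s in the term of index \<open>n\<close>: slots up to k carry 1/s,
  later slots carry s.\<close>

definition shift :: "(nat \<Rightarrow> nat) \<Rightarrow> complex" where
  "shift n = (\<Sum>l=1..k. of_nat (n l)) - (\<Sum>l=k+1..m. of_nat (n l))"

definition term_coeff :: "(nat \<Rightarrow> nat) \<Rightarrow> complex" where
  "term_coeff n = (\<Prod>l=1..m. (factor_expo l gchoose n l) * (-1) ^ n l * ratio l ^ n l)"

lemma sum_signed_eq_minus_shift: "(\<Sum>l=1..m. (if l \<le> k then - of_nat (n l) else of_nat (n l))) = - shift n"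
proof -
  have "{1..m} = {1..k} \<union> {k+1..m}" using k by auto
  then have "(\<Sum>l=1..m. (if l \<le> k then - of_nat (n l) else of_nat (n l) :: complex)) =
     (\<Sum>l=1..k. (if l \<le> k then - of_nat (n l) else of_nat (n l))) + (\<Sum>l=k+1..m. (if l \<le> k then - of_nat (n l) else of_nat (n l)))"
    by (simp only:) (rule sum.union_disjoint, auto)
  also have "\<dots> = (\<Sum>l=1..k. - of_nat (n l)) + (\<Sum>l=k+1..m. of_nat (n l))"
    by (intro arg_cong2[where f = plus] sum.cong) auto
  finally show ?thesis by (simp add: shift_def sum_negf)
qed

text \<open>The path enters the terms only through \<open>beta_integral\<close>. The expansions for
  the three paths therefore share their coefficients and can be combined term by term.\<close>

lemma path_integral_has_sum:
  assumes P: "lifted_path \<epsilon> \<sigma> A B d"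
  shows "((\<lambda>n. prefactor * (term_coeff n * beta_integral A B d (c - lower_sum - 1 - shift n) (1 - b k))) has_sum
    integral {0..1} (\<lambda>\<tau>. u_along (- pi) m a b c x (\<lambda>\<tau>. x k / \<sigma> \<tau>) \<tau> * phi0 (x k / \<sigma> \<tau>) *
      vector_derivative (\<lambda>\<tau>. x k / \<sigma> \<tau>) (at \<tau> within {0..1}))) (multi_indices m)"
proof -
  note D = lifted_pathD[OF P]
  define g where "g \<tau> = exp ((c - lower_sum - 1 - 1) * A \<tau>) * exp ((1 - b k - 1) * B \<tau>) * d \<tau>" for \<tau>
  have "((\<lambda>n. integral {0..1} (\<lambda>\<tau>. g \<tau> * (\<Prod>l=1..m. (factor_expo l gchoose n l) * (- factor l (\<sigma> \<tau>)) ^ n l))) has_sum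
      integral {0..1} (\<lambda>\<tau>. g \<tau> * (\<Prod>l=1..m. (1 - factor l (\<sigma> \<tau>)) powr factor_expo l))) (PiE {1..m} (\<lambda>_. UNIV))"
  proof (rule has_sum_integral_binomial_series)
    show "continuous_on {0..1} g" unfolding g_def by (intro continuous_intros D(1,2,3))
    show "continuous_on {0..1} (\<lambda>\<tau>. factor l (\<sigma> \<tau>))" for l by (rule continuous_factor[OF P])
    show "norm (factor l (\<sigma> \<tau>)) \<le> factor_bound l" if "\<tau> \<in> {0..1}" for l \<tau>
      using D(8,9)[OF that] by (rule norm_factor_le)
  qed (use factor_bound_less_1 in auto)
  also have "(\<lambda>n. integral {0..1} (\<lambda>\<tau>. g \<tau> * (\<Prod>l=1..m. (factor_expo l gchoose n l) * (- factor l (\<sigma> \<tau>)) ^ n l))) =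
     (\<lambda>n. term_coeff n * beta_integral A B d (c - lower_sum - 1 - shift n) (1 - b k))"
  proof
    fix n
    have "g \<tau> * (\<Prod>l=1..m. (factor_expo l gchoose n l) * (- factor l (\<sigma> \<tau>)) ^ n l) =
       term_coeff n * (exp ((c - lower_sum - 1 - shift n - 1) * A \<tau>) * exp ((1 - b k - 1) * B \<tau>) * d \<tau>)"
      if t: "\<tau> \<in> {0..1}" for \<tau>
    proof -
      have "(\<Prod>l=1..m. (factor_expo l gchoose n l) * (- factor l (\<sigma> \<tau>)) ^ n l) =
         (\<Prod>l=1..m. ((factor_expo l gchoose n l) * (-1) ^ n l * ratio l ^ n l) *
           exp ((if l \<le> k then - of_nat (n l) else of_nat (n l)) * A \<tau>))"
        using factor_power[OF D(6)[OF t]]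
        by (intro prod.cong refl) (simp only: power_minus[of "factor _ _"] mult.assoc)
      also have "\<dots> = term_coeff n * exp ((\<Sum>l=1..m. (if l \<le> k then - of_nat (n l) else of_nat (n l))) * A \<tau>)"
        unfolding prod.distrib term_coeff_def sum_distrib_right by (simp only: exp_sum finite_atLeastAtMost)
      finally have 1: "(\<Prod>l=1..m. (factor_expo l gchoose n l) * (- factor l (\<sigma> \<tau>)) ^ n l) =
         term_coeff n * exp (- shift n * A \<tau>)" unfolding sum_signed_eq_minus_shift .
      have 2: "exp ((c - lower_sum - 1 - shift n - 1) * A \<tau>) = exp ((c - lower_sum - 1 - 1) * A \<tau>) * exp (- shift n * A \<tau>)"
        unfolding exp_add[symmetric] by (simp add: algebra_simps)
      show ?thesis unfolding 1 2 g_def by (simp only: mult_ac)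
    qed
    then have "integral {0..1} (\<lambda>\<tau>. g \<tau> * (\<Prod>l=1..m. (factor_expo l gchoose n l) * (- factor l (\<sigma> \<tau>)) ^ n l)) =
      integral {0..1} (\<lambda>\<tau>. term_coeff n * (exp ((c - lower_sum - 1 - shift n - 1) * A \<tau>) * exp ((1 - b k - 1) * B \<tau>) * d \<tau>))"
      by (rule integral_cong)
    then show "integral {0..1} (\<lambda>\<tau>. g \<tau> * (\<Prod>l=1..m. (factor_expo l gchoose n l) * (- factor l (\<sigma> \<tau>)) ^ n l)) =
      term_coeff n * beta_integral A B d (c - lower_sum - 1 - shift n) (1 - b k)"
      by (simp add: beta_integral_def)
  qed
  finally have "((\<lambda>n. prefactor * (term_coeff n * beta_integral A B d (c - lower_sum - 1 - shift n) (1 - b k))) has_sum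
     prefactor * integral {0..1} (\<lambda>\<tau>. g \<tau> * (\<Prod>l=1..m. (1 - factor l (\<sigma> \<tau>)) powr factor_expo l))) (multi_indices m)"
    unfolding multi_indices_def by (rule has_sum_cmult_right)
  also have "prefactor * integral {0..1} (\<lambda>\<tau>. g \<tau> * (\<Prod>l=1..m. (1 - factor l (\<sigma> \<tau>)) powr factor_expo l)) =
     integral {0..1} (\<lambda>\<tau>. prefactor * (g \<tau> * (\<Prod>l=1..m. (1 - factor l (\<sigma> \<tau>)) powr factor_expo l)))" by simp
  also have "\<dots> = integral {0..1} (\<lambda>\<tau>. u_along (- pi) m a b c x (\<lambda>\<tau>. x k / \<sigma> \<tau>) \<tau> * phi0 (x k / \<sigma> \<tau>) *
      vector_derivative (\<lambda>\<tau>. x k / \<sigma> \<tau>) (at \<tau> within {0..1}))"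
    by (rule integral_cong) (simp only: integrand_eq[OF P] g_def)
  finally show ?thesis .
qed

end

section \<open>Comparison of the coefficients\<close>

lemma one_minus_notin_Ints:
  fixes z :: complex
  assumes "z \<notin> \<int>"
  shows "1 - z \<notin> \<int>"
  using assms Ints_diff[OF Ints_1, of "1 - z"] by auto

context near_base
begin

lemma shift_int: "shift n = of_int ((\<Sum>l=1..k. int (n l)) - (\<Sum>l=k+1..m. int (n l)))"
  by (simp add: shift_def)

lemma one_plus_shift_Ints: "1 + shift n \<in> \<int>"
  unfolding shift_int by (intro Ints_add Ints_1 Ints_of_int)

lemma loaded_integral_r_cycle:
  "loaded_integral (r_cycle m a b c k \<epsilon> x) phi0 =
    (let I = \<lambda>\<sigma>. integral {0..1} (\<lambda>\<tau>. u_along (- pi) m a b c x (\<lambda>\<tau>. x k / \<sigma> \<tau>) \<tau> * phi0 (x k / \<sigma> \<tau>) *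
        vector_derivative (\<lambda>\<tau>. x k / \<sigma> \<tau>) (at \<tau> within {0..1}))
     in 1 / ((\<Prod>l=1..k-1. lam m a b c l) * lam m a b c (m+1) * lam m a b c (m+2) - 1) * I (circlepath 0 \<epsilon>) +
        I (linepath (of_real \<epsilon>) (of_real (1 - \<epsilon>))) +
        - 1 / (lam m a b c k - 1) * I (part_circlepath 1 \<epsilon> pi (3 * pi)))"
  by (simp add: loaded_integral_def r_cycle_def s_cycle_def Let_def)

text \<open>The integer 1 is added to -b_k to match the denominator of \<open>reg_beta\<close> at q
  = 1 - b_k.\<close>

lemma lam_k: "lam m a b c k = exp (2 * of_real pi * \<i> * (1 - b k))"
proof -
  have "exp (2 * of_real pi * \<i> * (1 - b k)) = exp (2 * of_real pi * \<i> * (- b k)) * exp (2 * of_real pi * \<i>)"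
    unfolding exp_add[symmetric] by (simp add: algebra_simps)
  then show ?thesis using k by (simp add: lam_def expo_def)
qed

lemma exp_two_pi_i_add_int: "exp (2 * of_real pi * \<i> * (z + of_int n)) = exp (2 * of_real pi * \<i> * z)"
proof -
  have "exp (2 * of_real pi * \<i> * (z + of_int n)) = exp (2 * of_real pi * \<i> * z) * exp (2 * of_int n * of_real pi * \<i>)"
    unfolding exp_add[symmetric] by (simp add: algebra_simps)
  also have "exp (2 * of_int n * of_real pi * \<i>) = 1"
    by (auto simp: exp_eq_1 intro!: exI[of _ n])
  finally show ?thesis by simp
qed

text \<open>The monodromy of the integrand around s = 0. The parameter \<open>a\<close> drops out,
  since the exponents at 1 and at infinity add up to c.\<close>

lemma lam_prod:
  "(\<Prod>l=1..k-1. lam m a b c l) * lam m a b c (m+1) * lam m a b c (m+2) =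
     exp (2 * of_real pi * \<i> * (c - lower_sum))"
proof -
  have "(\<Prod>l=1..k-1. lam m a b c l) = (\<Prod>l=1..k-1. exp (2 * of_real pi * \<i> * (- b l)))"
    using k by (intro prod.cong) (auto simp: lam_def expo_def)
  also have "\<dots> = exp (2 * of_real pi * \<i> * (- lower_sum))"
    unfolding lower_sum_def sum_negf[symmetric] sum_distrib_left by (simp only: exp_sum finite_atLeastAtMost)
  finally show ?thesis
    by (simp only: lam_def expo_def) (simp add: exp_add[symmetric] algebra_simps)
qed

text \<open>The first beta parameter differs from \<open>c - lower_sum\<close> by an integer, so the
  denominators in \<open>reg_beta\<close> are the same for all \<open>n\<close> and equal those of
  the cycle.\<close>

lemma reg_beta_shift:
  "prefactor * (term_coeff n * reg_beta \<epsilon> (c - lower_sum - 1 - shift n) (1 - b k)) =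
    1 / ((\<Prod>l=1..k-1. lam m a b c l) * lam m a b c (m+1) * lam m a b c (m+2) - 1) *
      (prefactor * (term_coeff n * loop_beta \<epsilon> (c - lower_sum - 1 - shift n) (1 - b k))) +
    prefactor * (term_coeff n * seg_beta \<epsilon> (c - lower_sum - 1 - shift n) (1 - b k)) +
    - 1 / (lam m a b c k - 1) * (prefactor * (term_coeff n * - loop_beta \<epsilon> (1 - b k) (c - lower_sum - 1 - shift n)))"
proof -
  define j where "j = - 1 - ((\<Sum>l=1..k. int (n l)) - (\<Sum>l=k+1..m. int (n l)))"
  have "c - lower_sum - 1 - shift n = (c - lower_sum) + of_int j"
    by (simp add: shift_int j_def)
  then have "exp (2 * of_real pi * \<i> * (c - lower_sum - 1 - shift n)) = exp (2 * of_real pi * \<i> * (c - lower_sum))"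
    by (simp only: exp_two_pi_i_add_int)
  then show ?thesis
    unfolding reg_beta_def lam_prod lam_k by (simp add: algebra_simps)
qed

lemma loaded_integral_has_sum:
  assumes "c - lower_sum \<notin> \<int>" "b k \<notin> \<int>"
  shows "((\<lambda>n. prefactor * (term_coeff n * Beta (c - lower_sum - 1 - shift n) (1 - b k))) has_sum
    loaded_integral (r_cycle m a b c k \<epsilon> x) phi0) (multi_indices m)"
proof -
  have p: "c - lower_sum - 1 - shift n \<notin> \<int>" for n
  proof
    assume "c - lower_sum - 1 - shift n \<in> \<int>"
    then have "(c - lower_sum - 1 - shift n) + (1 + shift n) \<in> \<int>"
      using one_plus_shift_Ints by (rule Ints_add)
    then show False using assms by simp
  qed
  have q: "1 - b k \<notin> \<int>" using assms(2) by (rule one_minus_notin_Ints)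
  have minus: "beta_integral A B (\<lambda>\<tau>. - d \<tau>) r s = - beta_integral B A d s r" for A B d r s
    unfolding beta_integral_def by (simp add: mult_ac)
  have third: "beta_integral (\<lambda>\<tau>. Ln (1 - exp (loop_log \<epsilon> \<tau>))) (loop_log \<epsilon>)
      (\<lambda>\<tau>. - (2 * of_real pi * \<i> * exp (loop_log \<epsilon> \<tau>))) r s = - loop_beta \<epsilon> s r" for r s
    unfolding minus loop_beta_def ..
  note H = path_integral_has_sum[OF lifted_path_loop[OF eps], folded loop_beta_def]
    path_integral_has_sum[OF lifted_path_seg[OF eps], folded seg_beta_def]
    path_integral_has_sum[OF lifted_path_loop_one[OF eps], unfolded third]
  show ?thesis
    unfolding loaded_integral_r_cycle Let_def reg_beta_eq_Beta[OF eps p q, symmetric] reg_beta_shift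
    by (intro has_sum_add has_sum_cmult_right H)
qed

definition gamma_factor :: complex where
  "gamma_factor = Gamma (c - a) * (\<Prod>l=1..m. Gamma (1 - b l)) * Gamma (lower_sum - c) * Gamma (1 - lower_sum + c)"

text \<open>Binomial coefficients become Gamma quotients, and the reflection formula moves the Gamma
  factor containing the shift into the denominator. Its sign (-1)^N cancels the sign of the binomial
  expansion. Slot k yields \<open>Gamma (c - a)\<close>, so the missing
  \<open>Gamma (1 - b k)\<close> comes from the Beta function.\<close>

lemma term_coeff_Beta:
  assumes ca: "c - a \<notin> \<int>" and b: "\<And>l. l \<in> {1..m} \<Longrightarrow> b l \<notin> \<int>" and cb: "c - lower_sum \<notin> \<int>"
  shows "term_coeff n * Beta (c - lower_sum - 1 - shift n) (1 - b k) = gamma_factor * f_term m k a b c x n"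
proof -
  have nonpos: "z \<notin> \<int>\<^sub>\<le>\<^sub>0" if "z \<notin> \<int>" for z :: complex
    using that nonpos_Ints_subset_Ints by blast
  have b1: "1 - b l \<notin> \<int>" if "l \<in> {1..m}" for l
    using b[OF that] by (rule one_minus_notin_Ints)
  define N where "N = (\<Sum>l=1..k. int (n l)) - (\<Sum>l=k+1..m. int (n l))"
  have N: "shift n = of_int N" by (simp add: shift_int N_def)
  have gb: "(z gchoose j) = Gamma (z + 1) * rGamma (1 + of_nat j) * rGamma (z + 1 - of_nat j)"
    if "z + 1 \<notin> \<int>" for z :: complex and j
    using gbinomial_Gamma[OF nonpos[OF that], of j]
    by (simp add: rGamma_inverse_Gamma Gamma_fact[symmetric] divide_inverse algebra_simps)
  \<comment> \<open>This is \<open>factor_expo l + 1\<close>, the argument of the numerator Gamma of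
    the l-th binomial coefficient.\<close>
  define G where "G l = (if l = k then c - a else 1 - b l)" for l
  have G: "(factor_expo l gchoose n l) = Gamma (G l) * rGamma (1 + of_nat (n l)) * rGamma (G l - of_nat (n l))"
    if "l \<in> {1..m}" for l
    using gb[of "factor_expo l" "n l"] ca b1[OF that] by (auto simp: factor_expo_def G_def)
  \<comment> \<open>The sum of all indices and the signed sum N have the same parity.\<close>
  have sgn: "(\<Prod>l=1..m. (-1) ^ n l) = (-1 :: complex) powi N"
  proof -
    have "{1..m} = {1..k} \<union> {k+1..m}" using k by auto
    then have "(\<Prod>l=1..m. (-1) ^ n l) = (\<Prod>l=1..k. (-1) ^ n l) * (\<Prod>l=k+1..m. (-1 :: complex) ^ n l)"
      by (simp only:) (rule prod.union_disjoint, auto)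
    also have "\<dots> = (-1) ^ (\<Sum>l=1..k. n l) * (-1) ^ (\<Sum>l=k+1..m. n l)"
      by (simp only: power_sum)
    also have "\<dots> = (-1) powi (int (\<Sum>l=1..k. n l) - int (\<Sum>l=k+1..m. n l))"
      by (simp add: power_int_diff minus_one_power_iff del: of_nat_sum)
    finally show ?thesis by (simp add: N_def)
  qed
  have km: "k \<in> {1..m}" using k by simp
  have rem: "(\<Prod>l=1..m. f l) = f k * (\<Prod>l\<in>{1..m} - {k}. f l)" for f :: "nat \<Rightarrow> complex"
    using km by (intro prod.remove) auto
  have split: "(\<Prod>l=1..m. ratio l ^ n l) =
      (\<Prod>l=1..k-1. (x k / x l) ^ n l) * x k ^ n k * (\<Prod>l=k+1..m. (x l / x k) ^ n l)"
    unfolding prod_split_at[OF k, of "\<lambda>l. ratio l ^ n l"]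
    by (intro arg_cong2[where f = times] prod.cong) (auto simp: ratio_def)
  have 1: "term_coeff n = Gamma (c - a) * (\<Prod>l\<in>{1..m}-{k}. Gamma (1 - b l)) *
     (\<Prod>l=1..m. rGamma (1 + of_nat (n l))) *
     (rGamma (c - a - of_nat (n k)) * (\<Prod>l\<in>{1..m}-{k}. rGamma (1 - b l - of_nat (n l)))) *
     (-1) powi N *
     ((\<Prod>l=1..k-1. (x k / x l) ^ n l) * x k ^ n k * (\<Prod>l=k+1..m. (x l / x k) ^ n l))"
  proof -
    have "term_coeff n = (\<Prod>l=1..m. Gamma (G l) * rGamma (1 + of_nat (n l)) * rGamma (G l - of_nat (n l)) * (-1) ^ n l * ratio l ^ n l)"
      unfolding term_coeff_def using G by (intro prod.cong) auto
    also have "\<dots> = (\<Prod>l=1..m. Gamma (G l)) * (\<Prod>l=1..m. rGamma (1 + of_nat (n l))) *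
      (\<Prod>l=1..m. rGamma (G l - of_nat (n l))) * (-1) powi N * (\<Prod>l=1..m. ratio l ^ n l)"
      by (simp only: prod.distrib sgn)
    also have "(\<Prod>l=1..m. Gamma (G l)) = Gamma (c - a) * (\<Prod>l\<in>{1..m}-{k}. Gamma (1 - b l))"
      unfolding rem[of "\<lambda>l. Gamma (G l)"] by (intro arg_cong2[where f = times] prod.cong) (auto simp: G_def)
    also have "(\<Prod>l=1..m. rGamma (G l - of_nat (n l))) =
        rGamma (c - a - of_nat (n k)) * (\<Prod>l\<in>{1..m}-{k}. rGamma (1 - b l - of_nat (n l)))"
      unfolding rem[of "\<lambda>l. rGamma (G l - of_nat (n l))"] by (intro arg_cong2[where f = times] prod.cong) (auto simp: G_def)
    finally show ?thesis unfolding split .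
  qed
  let ?p = "c - lower_sum - 1 - shift n"
  have refl: "(-1) powi N * Gamma ?p = Gamma (lower_sum - c) * Gamma (1 - lower_sum + c) * rGamma (2 + lower_sum - c + shift n)"
  proof -
    have pn: "?p \<notin> \<int>"
    proof
      assume "?p \<in> \<int>"
      then have "?p + (1 + shift n) \<in> \<int>" using one_plus_shift_Ints by (rule Ints_add)
      then show False using cb by simp
    qed
    have "1 - ?p \<notin> \<int>" using pn by (rule one_minus_notin_Ints)
    then have g1: "Gamma (1 - ?p) * rGamma (1 - ?p) = 1"
      using nonpos by (simp add: Gamma_def rGamma_eq_zero_iff)
    have m1: "(-1 :: complex) powi N = (if even N then 1 else -1)" by (simp add: power_int_minus_left)
    have "sin (of_real pi * of_int (1 + N)) = complex_of_real (sin (pi * of_int (1 + N)))"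
      "cos (of_real pi * of_int (1 + N)) = complex_of_real (cos (pi * of_int (1 + N)))"
      using sin_of_real[of "pi * of_int (1 + N)", where 'a = complex]
        cos_of_real[of "pi * of_int (1 + N)", where 'a = complex]
      by (simp_all only: of_real_mult of_real_of_int_eq)
    then have sc: "sin (of_real pi * of_int (1 + N)) = (0 :: complex)"
      "cos (of_real pi * of_int (1 + N)) = - ((-1 :: complex) powi N)"
      unfolding sin_npi_int cos_npi_int m1 by simp_all
    \<comment> \<open>Shifting by 1 + N half-turns multiplies the sine by -(-1)^N. The leading minus
      is absorbed by the oddness of sine in \<open>s2\<close>.\<close>
    have "of_real pi * ?p = of_real pi * (c - lower_sum) - of_real pi * of_int (1 + N)"
      by (simp add: N algebra_simps)
    then have s: "sin (of_real pi * ?p) = - ((-1) powi N * sin (of_real pi * (c - lower_sum)))"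
      by (simp only: sin_diff sc) (simp add: mult.commute)
    have s2: "sin (of_real pi * (lower_sum - c)) = - sin (of_real pi * (c - lower_sum))"
      unfolding sin_minus[symmetric] by (simp add: algebra_simps)
    have pp: "(-1 :: complex) powi N * (-1) powi N = 1" by (simp add: m1)
    have "(-1) powi N * Gamma ?p = (-1) powi N * (Gamma ?p * Gamma (1 - ?p)) * rGamma (1 - ?p)"
      using g1 by (simp add: mult.assoc)
    also have "Gamma ?p * Gamma (1 - ?p) = (-1) powi N * (Gamma (lower_sum - c) * Gamma (1 - (lower_sum - c)))"
      unfolding Gamma_reflection_complex s s2 m1 by simp
    also have "(-1) powi N * ((-1) powi N * (Gamma (lower_sum - c) * Gamma (1 - (lower_sum - c)))) * rGamma (1 - ?p) =
        Gamma (lower_sum - c) * Gamma (1 - (lower_sum - c)) * rGamma (1 - ?p)"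
      using pp by (simp only: mult.assoc[symmetric] mult_1)
    finally show ?thesis by (simp add: algebra_simps)
  qed
  have tgt: "f_term m k a b c x n = rGamma (c - a - of_nat (n k)) *
     (\<Prod>l\<in>{1..m} - {k}. rGamma (1 - b l - of_nat (n l))) *
     (\<Prod>l=1..m. rGamma (1 + of_nat (n l))) * rGamma (?p + (1 - b k)) * rGamma (2 + lower_sum - c + shift n) *
     (\<Prod>l=1..k-1. (x k / x l) ^ n l) * x k ^ n k * (\<Prod>l=k+1..m. (x l / x k) ^ n l)"
  proof -
    have "{1..k} = insert k {1..k-1}" using k by auto
    then have "(\<Sum>l=1..k. b l) = b k + lower_sum" using k by (simp add: lower_sum_def)
    then have "- (\<Sum>l=1..k. b l) + c - (\<Sum>l=1..k. of_nat (n l)) + (\<Sum>l=k+1..m. of_nat (n l)) = ?p + (1 - b k)"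
      by (simp add: shift_def algebra_simps)
    moreover have "2 + (\<Sum>l=1..k-1. b l) - c + (\<Sum>l=1..k. of_nat (n l)) - (\<Sum>l=k+1..m. of_nat (n l)) = 2 + lower_sum - c + shift n"
      by (simp add: shift_def lower_sum_def algebra_simps)
    ultimately show ?thesis unfolding f_term_def rGamma_coeff_def by (simp only: )
  qed
  have gf: "gamma_factor = Gamma (c - a) * (Gamma (1 - b k) * (\<Prod>l\<in>{1..m}-{k}. Gamma (1 - b l))) *
      (Gamma (lower_sum - c) * Gamma (1 - lower_sum + c))"
    unfolding gamma_factor_def rem[of "\<lambda>l. Gamma (1 - b l)"] by (simp only: mult.assoc)
  have "term_coeff n * Beta ?p (1 - b k) = Gamma (c - a) * (\<Prod>l\<in>{1..m}-{k}. Gamma (1 - b l)) *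
     (\<Prod>l=1..m. rGamma (1 + of_nat (n l))) *
     (rGamma (c - a - of_nat (n k)) * (\<Prod>l\<in>{1..m}-{k}. rGamma (1 - b l - of_nat (n l)))) *
     ((-1) powi N * Gamma ?p) * Gamma (1 - b k) * rGamma (?p + (1 - b k)) *
     ((\<Prod>l=1..k-1. (x k / x l) ^ n l) * x k ^ n k * (\<Prod>l=k+1..m. (x l / x k) ^ n l))"
    unfolding 1 Beta_altdef by (simp only: mult_ac)
  then show ?thesis unfolding refl gf tgt by (simp only: mult_ac)
qed

text \<open>This allows division by the constant, so that summability of the \<open>f_term\<close>
  family can be read off from the expansion of the integral. \<open>Gamma\<close> takes the value 0
  exactly at its poles, and these are excluded.\<close>

lemma gamma_factor_nonzero:
  assumes ca: "c - a \<notin> \<int>" and b: "\<And>l. l \<in> {1..m} \<Longrightarrow> b l \<notin> \<int>" and cb: "c - lower_sum \<notin> \<int>"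
  shows "gamma_factor \<noteq> 0"
proof -
  have G: "Gamma z \<noteq> 0" if "z \<notin> \<int>" for z :: complex
    using that nonpos_Ints_subset_Ints by (auto simp: Gamma_eq_zero_iff)
  have b1: "1 - b l \<notin> \<int>" if "l \<in> {1..m}" for l
    using b[OF that] by (rule one_minus_notin_Ints)
  have "lower_sum - c \<notin> \<int>" using cb Ints_minus[of "lower_sum - c"] by auto
  moreover have "1 - lower_sum + c \<notin> \<int>" 
    using cb Ints_diff[OF _ Ints_1, of "1 - lower_sum + c"] by (auto simp: algebra_simps)
  ultimately show ?thesis using G ca b1 by (auto simp: gamma_factor_def)
qed

lemma integral_formula:
  assumes ca: "c - a \<notin> \<int>" and b: "\<And>l. l \<in> {1..m} \<Longrightarrow> b l \<notin> \<int>" and cb: "c - lower_sum \<notin> \<int>"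
  shows "f_term m k a b c x summable_on multi_indices m"
    "loaded_integral (r_cycle m a b c k \<epsilon> x) phi0 =
      gamma_factor * exp (of_real pi * \<i> * (lower_sum - c + a)) * f_series m k a b c x"
proof -
  have km: "k \<in> {1..m}" using k by simp
  have pf: "prefactor \<noteq> 0"
    unfolding prefactor_def using x_lower(2) by (auto simp: powr_at_def)
  let ?I = "loaded_integral (r_cycle m a b c k \<epsilon> x) phi0"
  have hs: "((\<lambda>n. (prefactor * gamma_factor) * f_term m k a b c x n) has_sum ?I) (multi_indices m)"
  proof -
    have "prefactor * (term_coeff n * Beta (c - lower_sum - 1 - shift n) (1 - b k)) =
        (prefactor * gamma_factor) * f_term m k a b c x n" for n
      using term_coeff_Beta[OF ca b cb, of n] by (simp add: mult.assoc)
    then show ?thesis using loaded_integral_has_sum[OF cb b[OF km]] by (simp only:)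
  qed
  have nz: "prefactor * gamma_factor \<noteq> 0" using pf gamma_factor_nonzero[OF assms] by simp
  have "(\<lambda>n. (prefactor * gamma_factor) * f_term m k a b c x n) summable_on multi_indices m"
    using hs by (rule has_sum_imp_summable)
  then show sm: "f_term m k a b c x summable_on multi_indices m"
    using nz by (simp add: summable_on_cmult_right')
  then have "((\<lambda>n. (prefactor * gamma_factor) * f_term m k a b c x n) has_sum
     (prefactor * gamma_factor) * (\<Sum>\<^sub>\<infinity>n\<in>multi_indices m. f_term m k a b c x n)) (multi_indices m)"
    by (intro has_sum_cmult_right has_sum_infsum)
  with hs have "?I = (prefactor * gamma_factor) * (\<Sum>\<^sub>\<infinity>n\<in>multi_indices m. f_term m k a b c x n)"
    by (rule has_sum_unique)
  then show "?I = gamma_factor * exp (of_real pi * \<i> * (lower_sum - c + a)) * f_series m k a b c x"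
    by (simp only: prefactor_def f_series_def lower_sum_def mult_ac)
qed

section \<open>The loaded chain is a cycle\<close>

text \<open>Each loop returns with its load multiplied by the monodromy \<mu> or \<nu>, so its
  boundary is (\<mu> - 1) or (\<nu> - 1) times the load at the base point. The coefficients of the
  cycle normalise this to cancel the endpoints of the segment.\<close>

lemma twisted_cycle:
  assumes bk: "b k \<notin> \<int>" and cb: "c - lower_sum \<notin> \<int>"
  shows "is_twisted_cycle m a b c x (r_cycle m a b c k \<epsilon> x)"
proof -
  have branch: "path (\<lambda>\<tau>. x k / \<sigma> \<tau>) \<and> path_image (\<lambda>\<tau>. x k / \<sigma> \<tau>) \<subseteq> T_space m x \<and>
      is_u_branch m a b c x (\<lambda>\<tau>. x k / \<sigma> \<tau>) (u_along (- pi) m a b c x (\<lambda>\<tau>. x k / \<sigma> \<tau>))"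
    if P: "lifted_path \<epsilon> \<sigma> A B d" for \<sigma> A B d
  proof (intro conjI)
    note D = lifted_pathD[OF P]
    note L = is_log_along_factor_log(1)[OF P]
    show "path (\<lambda>\<tau>. x k / \<sigma> \<tau>)"
      unfolding path_def using D(10,12) by (intro continuous_intros) auto
    show "is_u_branch m a b c x (\<lambda>\<tau>. x k / \<sigma> \<tau>) (u_along (- pi) m a b c x (\<lambda>\<tau>. x k / \<sigma> \<tau>))"
      unfolding is_u_branch_def using L u_along_eq[OF P] by (intro exI[of _ "factor_log \<sigma> A B"]) auto
    show "path_image (\<lambda>\<tau>. x k / \<sigma> \<tau>) \<subseteq> T_space m x"
    proof
      fix z assume "z \<in> path_image (\<lambda>\<tau>. x k / \<sigma> \<tau>)"
      then obtain \<tau> where t: "\<tau> \<in> {0..1}" "z = x k / \<sigma> \<tau>" by (auto simp: path_image_def)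
      \<comment> \<open>A quantity that has a logarithm is an exponential, hence nonzero.\<close>
      have "z - marked_pt m x i \<noteq> 0" if "i \<le> m + 1" for i
        using L[OF that] t exp_not_eq_zero by (metis is_log_along_def)
      then show "z \<in> T_space m x" by (force simp: T_space_def)
    qed
  qed
  let ?g = "\<lambda>\<sigma>::real \<Rightarrow> complex. \<lambda>\<tau>. x k / \<sigma> \<tau>"
  let ?u = "\<lambda>\<sigma>. u_along (- pi) m a b c x (?g \<sigma>)"
  let ?C0 = "circlepath 0 \<epsilon>" and ?S = "linepath (complex_of_real \<epsilon>) (of_real (1 - \<epsilon>))"
    and ?C1 = "part_circlepath 1 \<epsilon> pi (3 * pi)"
  note paths = lifted_path_loop[OF eps] lifted_path_seg[OF eps] lifted_path_loop_one[OF eps]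
  \<comment> \<open>The first exponential depends only on the point \<sigma> \<tau>; all monodromy
    is in the powers formed with \<open>A\<close> and \<open>B\<close>. Comparing loads at a common
    point thus reduces to comparing these two logarithms.\<close>
  have ev: "?u \<sigma> \<tau> = exp (of_real pi * \<i> * (lower_sum - c + a) + (\<Sum>l=1..k-1. - b l * Ln (x l)) + (lower_sum - c) * log_xk +
    (\<Sum>l=1..m. factor_expo l * Ln (1 - factor l (\<sigma> \<tau>))) + Ln (1 - factor k (\<sigma> \<tau>))) *
    exp ((c - lower_sum) * A \<tau>) * exp ((- b k) * B \<tau>)" if "lifted_path \<epsilon> \<sigma> A B d" "\<tau> \<in> {0..1}" for \<sigma> A B d \<tau>
  proof -
    have "?u \<sigma> \<tau> = exp (\<Sum>i=0..m+1. expo m a b c i * factor_log \<sigma> A B i \<tau>)"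
      unfolding u_along_eq[OF that] by (simp only: exp_sum finite_atLeastAtMost)
    then show ?thesis unfolding sum_expo_factor_log by (simp only: exp_add mult_ac)
  qed
  define \<mu> where "\<mu> = exp (2 * of_real pi * \<i> * (c - lower_sum))"
  define \<nu> where "\<nu> = lam m a b c k"
  have pts: "?C0 0 = of_real \<epsilon>" "?C0 1 = of_real \<epsilon>" "?S 0 = of_real \<epsilon>" "?S 1 = of_real (1 - \<epsilon>)"
    "?C1 0 = of_real (1 - \<epsilon>)" "?C1 1 = of_real (1 - \<epsilon>)"
    unfolding part_circlepath_eq_one_minus by (simp_all add: circlepath linepath_def)
  have re: "Ln (1 - complex_of_real \<epsilon>) = of_real (ln (1 - \<epsilon>))"
    using Ln_of_real[of "1 - \<epsilon>"] eps by simp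
  have lg: "loop_log \<epsilon> 0 = of_real (ln \<epsilon>)" "loop_log \<epsilon> 1 = of_real (ln \<epsilon>) + 2 * of_real pi * \<i>"
    "seg_log \<epsilon> 0 = of_real (ln \<epsilon>)" "seg_log \<epsilon> 1 = of_real (ln (1 - \<epsilon>))"
    by (simp_all add: loop_log_def seg_log_def)
  have ex: "exp (loop_log \<epsilon> 0) = of_real \<epsilon>" "exp (loop_log \<epsilon> 1) = of_real \<epsilon>"
    using eps by (simp_all add: exp_loop_log)
  have "\<nu> = exp ((- b k) * (2 * of_real pi * \<i>))"
    using k by (simp add: \<nu>_def lam_def expo_def mult_ac)
  then have \<nu>: "exp ((- b k) * (of_real (ln \<epsilon>) + 2 * of_real pi * \<i>)) = \<nu> * exp ((- b k) * of_real (ln \<epsilon>))"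
    by (simp only: ring_distribs exp_add mult_ac)
  have "\<mu> = exp ((c - lower_sum) * (2 * of_real pi * \<i>))" by (simp only: \<mu>_def mult_ac)
  then have \<mu>: "exp ((c - lower_sum) * (of_real (ln \<epsilon>) + 2 * of_real pi * \<i>)) = \<mu> * exp ((c - lower_sum) * of_real (ln \<epsilon>))"
    by (simp only: ring_distribs exp_add mult_ac)
  have t01: "(0::real) \<in> {0..1}" "(1::real) \<in> {0..1}" by simp_all
  have u0: "?u ?C0 1 = \<mu> * ?u ?C0 0" "?u ?S 0 = ?u ?C0 0"
    unfolding ev[OF paths(1) t01(1)] ev[OF paths(1) t01(2)] ev[OF paths(2) t01(1)] pts ex
    unfolding lg re \<mu> diff_0_right by (simp_all only: mult_ac)
  have u1: "?u ?C1 1 = \<nu> * ?u ?C1 0" "?u ?S 1 = ?u ?C1 0"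
    unfolding ev[OF paths(3) t01(1)] ev[OF paths(3) t01(2)] ev[OF paths(2) t01(2)] pts ex
    unfolding diff_self unfolding lg re \<nu> by (simp_all only: mult_ac)
  have \<mu>1: "\<mu> - 1 \<noteq> 0" unfolding \<mu>_def by (rule exp_two_pi_i_neq_1[OF cb])
  have "1 - b k \<notin> \<int>" using bk by (rule one_minus_notin_Ints)
  then have \<nu>1: "\<nu> - 1 \<noteq> 0" unfolding \<nu>_def lam_k by (rule exp_two_pi_i_neq_1)
  have "loaded_boundary (r_cycle m a b c k \<epsilon> x) z = 0" for z
  proof -
    have "loaded_boundary (r_cycle m a b c k \<epsilon> x) z =
       1 / (\<mu> - 1) * ((if x k / of_real \<epsilon> = z then \<mu> * ?u ?C0 0 else 0) - (if x k / of_real \<epsilon> = z then ?u ?C0 0 else 0)) +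
       ((if x k / of_real (1 - \<epsilon>) = z then ?u ?C1 0 else 0) - (if x k / of_real \<epsilon> = z then ?u ?C0 0 else 0)) +
       - 1 / (\<nu> - 1) * ((if x k / of_real (1 - \<epsilon>) = z then \<nu> * ?u ?C1 0 else 0) - (if x k / of_real (1 - \<epsilon>) = z then ?u ?C1 0 else 0))"
      unfolding loaded_boundary_def r_cycle_def s_cycle_def lam_prod \<mu>_def[symmetric] \<nu>_def[symmetric] Let_def
      by (simp only: list.map prod.case pathstart_def pathfinish_def pts u0 u1 add_0_right add.assoc mult_1_left sum_list.Cons sum_list.Nil)
    also have "\<dots> = 0" using \<mu>1 \<nu>1 by (auto simp: field_simps)
    finally show ?thesis .
  qed
  then show ?thesis
    unfolding is_twisted_cycle_def using branch[OF paths(1)] branch[OF paths(2)] branch[OF paths(3)]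
    by (auto simp: r_cycle_def s_cycle_def Let_def)
qed

end

section \<open>A neighbourhood of the base point\<close>

text \<open>At the base point the quotients in \<open>good_point\<close> have modulus \<xi>^|k - l|,
  at most \<xi>, which lies below both \<epsilon> and 1 / (1 + \<epsilon>). Strict inequalities
  between continuous functions persist nearby.\<close>

lemma good_point_near_base_pt:
  assumes k: "1 \<le> k" "k \<le> m" and eps: "0 < \<epsilon>" "\<epsilon> < 1 / 2" and xi: "0 < \<xi>" "\<xi> < min \<epsilon> (1 / (1 + \<epsilon>))"
  shows "\<exists>\<delta>>0. \<forall>x. (\<forall>l\<in>{1..m}. dist (x l) (base_pt k \<xi> l) < \<delta>) \<longrightarrow> good_point m k \<epsilon> x"
proof -
  let ?z = "base_pt k \<xi>"
  have xi1: "\<xi> < 1" using xi eps by simp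
  have zk: "?z k = - of_real (\<xi> ^ k)" by (simp add: base_pt_def exp_minus)
  have zl: "?z l = of_real (\<xi> ^ l)" if "l \<noteq> k" for l using that by (simp add: base_pt_def)
  have pow: "\<xi> ^ j \<le> \<xi>" if "1 \<le> j" for j
    using power_decreasing[of 1 j \<xi>] that xi xi1 by simp
  \<comment> \<open>Each condition involves only the pair (x_l, x_k), so openness is needed only in
    two complex variables; a minimum over the finitely many l then gives one radius.\<close>
  define Q where "Q l p \<longleftrightarrow> Re (snd p) < 0 \<and> norm (snd p) < \<epsilon> \<and> (l < k \<longrightarrow> 0 < Re (fst p) \<and> norm (snd p / fst p) < \<epsilon>) \<and>
     (k < l \<longrightarrow> norm (fst p / snd p) * (1 + \<epsilon>) < 1)" for l and p :: "complex \<times> complex"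
  have loc: "\<exists>\<delta>>0. \<forall>u v. dist u (?z l) < \<delta> \<longrightarrow> dist v (?z k) < \<delta> \<longrightarrow> Q l (u, v)" if l: "l \<in> {1..m}" for l
  proof -
    have nz: "?z k \<noteq> 0" "?z l \<noteq> 0" using xi by (auto simp: base_pt_def)
    have t: "(fst \<longlongrightarrow> ?z l) (nhds (?z l, ?z k))" "(snd \<longlongrightarrow> ?z k) (nhds (?z l, ?z k))"
      by (auto intro!: tendsto_eq_intros filterlim_ident)
    have "\<forall>\<^sub>F p in nhds (?z l, ?z k). Re (snd p) < 0"
      by (rule order_tendstoD(2)[OF tendsto_Re[OF t(2)]]) (use xi in \<open>simp add: zk\<close>)
    moreover have "\<forall>\<^sub>F p in nhds (?z l, ?z k). norm (snd p) < \<epsilon>"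
      by (rule order_tendstoD(2)[OF tendsto_norm[OF t(2)]]) (use xi pow[OF k(1)] in \<open>simp add: zk norm_power\<close>)
    moreover have "\<forall>\<^sub>F p in nhds (?z l, ?z k). l < k \<longrightarrow> 0 < Re (fst p) \<and> norm (snd p / fst p) < \<epsilon>"
    proof (cases "l < k")
      case True
      have "norm (?z k / ?z l) = \<xi> ^ (k - l)"
        using True xi by (simp add: zk zl norm_divide norm_power power_diff)
      also have "\<dots> \<le> \<xi>" by (rule pow) (use True in simp)
      also have "\<xi> < \<epsilon>" using xi by simp
      finally have "\<forall>\<^sub>F p in nhds (?z l, ?z k). norm (snd p / fst p) < \<epsilon>"
        by (intro order_tendstoD(2)[OF tendsto_norm[OF tendsto_divide[OF t(2,1) nz(2)]]])
      moreover have "\<forall>\<^sub>F p in nhds (?z l, ?z k). 0 < Re (fst p)"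
        by (rule order_tendstoD(1)[OF tendsto_Re[OF t(1)]]) (use xi True in \<open>simp add: zl\<close>)
      ultimately show ?thesis by eventually_elim simp
    qed simp
    moreover have "\<forall>\<^sub>F p in nhds (?z l, ?z k). k < l \<longrightarrow> norm (fst p / snd p) * (1 + \<epsilon>) < 1"
    proof (cases "k < l")
      case True
      have "norm (?z l / ?z k) = \<xi> ^ (l - k)"
        using True xi by (simp add: zk zl norm_divide norm_power power_diff)
      also have "\<dots> \<le> \<xi>" by (rule pow) (use True in simp)
      also have "\<xi> < 1 / (1 + \<epsilon>)" using xi by simp
      finally have "norm (?z l / ?z k) * (1 + \<epsilon>) < 1" using eps by (simp add: field_simps)
      then have "\<forall>\<^sub>F p in nhds (?z l, ?z k). norm (fst p / snd p) * (1 + \<epsilon>) < 1"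
        by (intro order_tendstoD(2)[OF tendsto_mult[OF tendsto_norm[OF tendsto_divide[OF t nz(1)]] tendsto_const]])
      then show ?thesis by eventually_elim simp
    qed simp
    ultimately have "\<forall>\<^sub>F p in nhds (?z l, ?z k). Q l p"
      unfolding Q_def by eventually_elim blast
    then obtain P1 P2 where P: "\<forall>\<^sub>F u in nhds (?z l). P1 u" "\<forall>\<^sub>F v in nhds (?z k). P2 v" "\<And>u v. P1 u \<Longrightarrow> P2 v \<Longrightarrow> Q l (u, v)"
      unfolding nhds_prod eventually_prod_filter by blast
    obtain d1 d2 where "d1 > 0" "\<And>u. dist u (?z l) < d1 \<Longrightarrow> P1 u" "d2 > 0" "\<And>v. dist v (?z k) < d2 \<Longrightarrow> P2 v"
      using P(1,2) unfolding eventually_nhds_metric by blast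
    then show ?thesis using P(3) by (intro exI[of _ "min d1 d2"]) auto
  qed
  then obtain D where D: "\<And>l. l \<in> {1..m} \<Longrightarrow> D l > 0"
    "\<And>l u v. l \<in> {1..m} \<Longrightarrow> dist u (?z l) < D l \<Longrightarrow> dist v (?z k) < D l \<Longrightarrow> Q l (u, v)"
    by metis
  define \<delta> where "\<delta> = Min (D ` {1..m})"
  have ne: "{1..m} \<noteq> {}" "k \<in> {1..m}" using k by auto
  have "\<delta> > 0" unfolding \<delta>_def using D(1) ne by (subst Min_gr_iff) auto
  moreover have "good_point m k \<epsilon> x" if x: "\<forall>l\<in>{1..m}. dist (x l) (?z l) < \<delta>" for x
  proof -
    have "Q l (x l, x k)" if l: "l \<in> {1..m}" for l
    proof (rule D(2)[OF l])
      have "\<delta> \<le> D l" unfolding \<delta>_def using l by (intro Min_le) auto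
      then show "dist (x l) (?z l) < D l" "dist (x k) (?z k) < D l" using x l ne by force+
    qed
    then show ?thesis using ne unfolding good_point_def Q_def by auto
  qed
  ultimately show ?thesis by blast
qed

theorem theorem12:
  fixes m k :: nat and a c :: complex and b :: "nat \<Rightarrow> complex" and \<epsilon> \<xi> :: real
  assumes "m \<ge> 1" and "1 \<le> k" and "k \<le> m"
    and "0 < \<epsilon>" and "\<epsilon> < 1 / 2" and "0 < \<xi>" and "\<xi> < min \<epsilon> (1 / (1 + \<epsilon>))"
    and "a \<notin> \<int>" and "c - a \<notin> \<int>" and "\<And>l. l \<in> {1..m} \<Longrightarrow> b l \<notin> \<int>"
    and "c - (\<Sum>l=1..m. b l) \<notin> \<int>" and "c - (\<Sum>l=1..k-1. b l) \<notin> \<int>"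
  shows "\<exists>\<delta>>0. \<forall>x :: nat \<Rightarrow> complex. (\<forall>l\<in>{1..m}. dist (x l) (base_pt k \<xi> l) < \<delta>) \<longrightarrow>
    is_twisted_cycle m a b c x (r_cycle m a b c k \<epsilon> x) \<and>
    f_term m k a b c x summable_on multi_indices m \<and>
    loaded_integral (r_cycle m a b c k \<epsilon> x) phi0 =
      Gamma (c - a) * (\<Prod>l=1..m. Gamma (1 - b l)) *
      Gamma ((\<Sum>l=1..k-1. b l) - c) * Gamma (1 - (\<Sum>l=1..k-1. b l) + c) *
      exp (of_real pi * \<i> * ((\<Sum>l=1..k-1. b l) - c + a)) *
      f_series m k a b c x"
proof -
  obtain \<delta> where \<delta>: "\<delta> > 0"
    "\<And>x. \<forall>l\<in>{1..m}. dist (x l) (base_pt k \<xi> l) < \<delta> \<Longrightarrow> good_point m k \<epsilon> x"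
    using good_point_near_base_pt[OF assms(2-7)] by blast
  show ?thesis
  proof (intro exI[of _ \<delta>] conjI[OF \<delta>(1)] allI impI)
    fix x :: "nat \<Rightarrow> complex" assume "\<forall>l\<in>{1..m}. dist (x l) (base_pt k \<xi> l) < \<delta>"
    then have "good_point m k \<epsilon> x" by (rule \<delta>(2))
    then interpret near_base m k a c b x \<epsilon> using assms by unfold_locales
    have cb: "c - lower_sum \<notin> \<int>" unfolding lower_sum_def by fact
    have bk: "b k \<notin> \<int>" using assms by simp
    show "is_twisted_cycle m a b c x (r_cycle m a b c k \<epsilon> x) \<and>
      f_term m k a b c x summable_on multi_indices m \<and>
      loaded_integral (r_cycle m a b c k \<epsilon> x) phi0 =
        Gamma (c - a) * (\<Prod>l=1..m. Gamma (1 - b l)) *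
        Gamma ((\<Sum>l=1..k-1. b l) - c) * Gamma (1 - (\<Sum>l=1..k-1. b l) + c) *
        exp (of_real pi * \<i> * ((\<Sum>l=1..k-1. b l) - c + a)) *
        f_series m k a b c x"
      using twisted_cycle[OF bk cb] integral_formula[OF assms(9,10) cb]
      unfolding gamma_factor_def lower_sum_def by blast
  qed
qed

end
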